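(* The connectedness locus $\mathcal N=\{(\beta_1,\beta_2)\in(1,\infty)^2: A_{\beta_1,\beta_2}\text{ is connected}\}$, i.e. the complement of $\mathcal S=\{(\beta_1,\beta_2)\in(1,\infty)^2: A_{\beta_1,\beta_2}\text{ is totally disconnected}\}$ in $(1,\infty)^2$, is not simply connected.
   Context: For $\beta_1,\beta_2>1$ and $i\in\{-1,1\}$ let $T_i(x,y)=\left(\frac{x+i}{\beta_1},\frac{y+i}{\beta_2}\right)$ on $\mathbb R^2$. $A_{\beta_1,\beta_2}$ is the unique non-empty compact set $A\subset\mathbb R^2$ with $A=T_1(A)\cup T_{-1}(A)$. For each $(\beta_1,\beta_2)$ the set $A_{\beta_1,\beta_2}$ is either connected or totally disconnected. *)

theory Defs
  imports "HOL-Analysis.Analysis"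
begin

definition affT :: "real \<Rightarrow> real \<Rightarrow> real \<Rightarrow> real \<times> real \<Rightarrow> real \<times> real" where
  "affT \<beta>1 \<beta>2 i p = ((fst p + i) / \<beta>1, (snd p + i) / \<beta>2)"

definition is_attractor :: "real \<Rightarrow> real \<Rightarrow> (real \<times> real) set \<Rightarrow> bool" where
  "is_attractor \<beta>1 \<beta>2 A \<longleftrightarrow>
     A \<noteq> {} \<and> compact A \<and> A = affT \<beta>1 \<beta>2 1 ` A \<union> affT \<beta>1 \<beta>2 (-1) ` A"

text \<open>Only meaningful for parameters greater than 1, where existence and uniqueness
  are shown in \<open>is_attractor_ex1\<close> below.\<close>

definition attractor :: "real \<Rightarrow> real \<Rightarrow> (real \<times> real) set" where
  "attractor \<beta>1 \<beta>2 = (THE A. is_attractor \<beta>1 \<beta>2 A)"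

definition totally_disconnected :: "'a::topological_space set \<Rightarrow> bool" where
  "totally_disconnected S \<longleftrightarrow> (\<forall>C. C \<subseteq> S \<and> connected C \<longrightarrow> (\<forall>x\<in>C. \<forall>y\<in>C. x = y))"

definition connectedness_locus :: "(real \<times> real) set" where
  "connectedness_locus = {(\<beta>1, \<beta>2). 1 < \<beta>1 \<and> 1 < \<beta>2 \<and> connected (attractor \<beta>1 \<beta>2)}"

definition disconnectedness_locus :: "(real \<times> real) set" where
  "disconnectedness_locus =
     {(\<beta>1, \<beta>2). 1 < \<beta>1 \<and> 1 < \<beta>2 \<and> totally_disconnected (attractor \<beta>1 \<beta>2)}"

lemma affT_dist_le:
  assumes "1 < b1" "1 < b2"
  shows "dist (affT b1 b2 i p) (affT b1 b2 i q) \<le> max (1/b1) (1/b2) * dist p q"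
proof -
  define r where "r = max (1/b1) (1/b2)"
  have r0: "0 \<le> r" using assms by (simp add: r_def le_max_iff_disj)
  have "dist ((fst p + i)/b1) ((fst q + i)/b1) = (1/b1) * dist (fst p) (fst q)"
    using assms by (simp add: dist_real_def diff_divide_distrib[symmetric])
  also have "\<dots> \<le> r * dist (fst p) (fst q)"
    by (intro mult_right_mono) (auto simp: r_def)
  finally have 1: "dist ((fst p + i)/b1) ((fst q + i)/b1) \<le> r * dist (fst p) (fst q)" .
  have "dist ((snd p + i)/b2) ((snd q + i)/b2) = (1/b2) * dist (snd p) (snd q)"
    using assms by (simp add: dist_real_def diff_divide_distrib[symmetric])
  also have "\<dots> \<le> r * dist (snd p) (snd q)"
    by (intro mult_right_mono) (auto simp: r_def)
  finally have 2: "dist ((snd p + i)/b2) ((snd q + i)/b2) \<le> r * dist (snd p) (snd q)" .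
  have "dist (affT b1 b2 i p) (affT b1 b2 i q)
      \<le> sqrt ((r * dist (fst p) (fst q))\<^sup>2 + (r * dist (snd p) (snd q))\<^sup>2)"
    unfolding affT_def dist_Pair_Pair
    by (intro real_sqrt_le_mono add_mono power_mono 1 2) auto
  also have "\<dots> = sqrt (r\<^sup>2 * ((dist (fst p) (fst q))\<^sup>2 + (dist (snd p) (snd q))\<^sup>2))"
    by (simp add: power_mult_distrib algebra_simps)
  also have "\<dots> = r * dist p q"
    using r0 by (simp add: real_sqrt_mult dist_prod_def)
  finally show ?thesis unfolding r_def .
qed

lemma is_attractor_subset:
  assumes b: "1 < b1" "1 < b2" and A: "is_attractor b1 b2 A" and B: "is_attractor b1 b2 B"
  shows "A \<subseteq> B"
proof -
  define r where "r = max (1/b1) (1/b2)"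
  have r: "0 \<le> r" "r < 1" using b by (auto simp: r_def le_max_iff_disj)
  from A B have A': "A \<noteq> {}" "compact A" "A = affT b1 b2 1 ` A \<union> affT b1 b2 (-1) ` A"
    and B': "B \<noteq> {}" "compact B" "B = affT b1 b2 1 ` B \<union> affT b1 b2 (-1) ` B"
    unfolding is_attractor_def by blast+
  have "continuous_on A (\<lambda>x. infdist x B)" by (intro continuous_intros)
  from continuous_attains_sup[OF A'(2,1) this]
  obtain x where x: "x \<in> A" "\<And>y. y \<in> A \<Longrightarrow> infdist y B \<le> infdist x B" by blast
  from x(1) A'(3) obtain i y where iy: "i = 1 \<or> i = -1" "y \<in> A" "x = affT b1 b2 i y" by blast
  from infdist_attains_inf[OF compact_imp_closed[OF B'(2)] B'(1), of y]
  obtain c where c: "c \<in> B" "infdist y B = dist y c" by blast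
  have "affT b1 b2 i c \<in> B" using iy(1) c(1) B'(3) by blast
  then have "infdist x B \<le> dist (affT b1 b2 i y) (affT b1 b2 i c)"
    unfolding iy(3) by (rule infdist_le)
  also have "\<dots> \<le> r * dist y c" unfolding r_def by (rule affT_dist_le[OF b])
  also have "\<dots> \<le> r * infdist x B"
    using x(2)[OF iy(2)] c(2) r by (intro mult_left_mono) auto
  finally have "(1 - r) * infdist x B \<le> 0" by (simp add: algebra_simps)
  then have "infdist x B \<le> 0" using r by (simp add: mult_le_0_iff)
  then have "infdist y B = 0" if "y \<in> A" for y
    using x(2)[OF that] infdist_nonneg[of y B] by linarith
  then show ?thesis
    using in_closed_iff_infdist_zero[OF compact_imp_closed[OF B'(2)] B'(1)] by blast
qed

lemma is_attractor_exists:
  assumes b: "1 < b1" "1 < b2"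
  shows "\<exists>A. is_attractor b1 b2 A"
proof -
  define c1 c2 where "c1 = 1/(b1-1)" and "c2 = 1/(b2-1)"
  have c: "c1 > 0" "c2 > 0" "c1 * b1 = c1 + 1" "c2 * b2 = c2 + 1"
    using b by (auto simp: c1_def c2_def field_simps)
  define F where "F X = affT b1 b2 1 ` X \<union> affT b1 b2 (-1) ` X" for X
  define K where "K n = (F ^^ n) ({-c1..c1} \<times> {-c2..c2})" for n
  have K_Suc: "K (Suc n) = F (K n)" for n by (simp add: K_def)
  have F_mono: "F X \<subseteq> F Y" if "X \<subseteq> Y" for X Y using that by (auto simp: F_def)
  have cont: "continuous_on X (affT b1 b2 i)" for X i
    unfolding affT_def using b by (intro continuous_intros) auto
  have inj: "inj (affT b1 b2 i)" for i
    using b by (auto simp: inj_on_def affT_def prod_eq_iff)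
  have comp: "compact (K n)" for n
  proof (induction n)
    case 0 show ?case by (simp add: K_def compact_Times)
  next
    case (Suc n) then show ?case
      unfolding K_Suc F_def by (intro compact_Un compact_continuous_image cont)
  qed
  have ne: "K n \<noteq> {}" for n
  proof (induction n)
    case 0 show ?case using c by (simp add: K_def)
  next
    case (Suc n) then show ?case unfolding K_Suc F_def by auto
  qed
  have box: "F ({-c1..c1} \<times> {-c2..c2}) \<subseteq> {-c1..c1} \<times> {-c2..c2}"
    using b c by (auto simp: F_def affT_def field_simps)
  have dec: "K (Suc n) \<subseteq> K n" for n
  proof (induction n)
    case 0 show ?case using box by (simp add: K_def)
  next
    case (Suc n) then show ?case by (metis F_mono K_Suc)
  qed
  have anti: "K n \<subseteq> K m" if "m \<le> n" for m n
    using dec lift_Suc_antimono_le[of K, OF _ that] by blast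
  define A where "A = (\<Inter>n. K n)"
  have "A \<noteq> {}" unfolding A_def by (rule compact_nest) (auto intro: comp ne dest: anti simp: ne)
  moreover have "compact A" unfolding A_def using comp by (intro compact_Inter) auto
  moreover have "A = F A"
  proof
    have "F A \<subseteq> K n" for n
    proof -
      have "F A \<subseteq> K (Suc n)" unfolding K_Suc by (rule F_mono) (auto simp: A_def)
      then show ?thesis using dec by blast
    qed
    then show "F A \<subseteq> A" by (auto simp: A_def)
    show "A \<subseteq> F A"
    proof (rule ccontr)
      assume "\<not> A \<subseteq> F A"
      then obtain x where x: "x \<in> A" "x \<notin> F A" by blast
      have img: "affT b1 b2 i ` A = (\<Inter>n. affT b1 b2 i ` K n)" for i
        unfolding A_def by (rule image_INT[OF inj]) auto
      from x(2) img obtain m n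
        where "x \<notin> affT b1 b2 1 ` K m" "x \<notin> affT b1 b2 (-1) ` K n"
        unfolding F_def by auto
      moreover have "K (max m n) \<subseteq> K m" "K (max m n) \<subseteq> K n" by (auto intro!: anti)
      ultimately have "x \<notin> K (Suc (max m n))" unfolding K_Suc F_def by blast
      with x(1) show False by (auto simp: A_def)
    qed
  qed
  ultimately have "is_attractor b1 b2 A" unfolding is_attractor_def F_def by blast
  then show ?thesis ..
qed

lemma is_attractor_ex1:
  assumes "1 < b1" "1 < b2"
  shows "\<exists>!A. is_attractor b1 b2 A"
  using is_attractor_exists[OF assms] is_attractor_subset[OF assms] by (metis subset_antisym)

lemma is_attractor_attractor:
  assumes "1 < b1" "1 < b2"
  shows "is_attractor b1 b2 (attractor b1 b2)"
  unfolding attractor_def by (rule theI'[OF is_attractor_ex1[OF assms]])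

end

theory Submission
  imports Defs "HOL-Complex_Analysis.Winding_Numbers"
begin

text \<open>
  Why the locus has a hole. Write \<open>M = diag(b1, b2)\<close> for the expanding matrix of the two maps and
  \<open>D = (A - A) / 2\<close> for the halved difference set of the attractor \<open>A\<close>. The two pieces of \<open>A\<close> meet
  iff \<open>(1, 1) \<in> D\<close>, and \<open>D\<close> is exactly the set of vectors with a bounded orbit under
  \<open>v \<mapsto> M v + (d, d)\<close> for some sequence of digits \<open>d \<in> {-1, 0, 1}\<close>; in other words, \<open>(1, 1) \<in> D\<close> says
  that some power series with constant term \<open>1\<close> and coefficients \<open>-1, 0, 1\<close> vanishes at both \<open>1/b1\<close>
  and \<open>1/b2\<close>. Meeting pieces make \<open>A\<close> a decreasing intersection of connected compact sets
  (\<open>connected_if_pieces_meet\<close>); disjoint pieces split every connected subset into ever smaller copies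
  (\<open>totally_disconnected_if_pieces_disjoint\<close>). This is the dichotomy.

  The hole is explicit. At one parameter near \<open>(1.6532, 1.3092)\<close> every digit string of length
  28 drives \<open>(1, 1)\<close> out of a box containing \<open>D\<close> at some step, so the attractor is
  totally disconnected there. On the other hand the whole boundary of a small rectangle around that
  parameter lies in the locus. To see this for a continuum of parameters at once, one uses an octagon
  \<open>K\<close> of vectors with the property that each point of \<open>K\<close> is carried back into
  \<open>K\<close> by some non-empty digit string. A bounded set with this property is contained in
  \<open>D\<close> (\<open>recurrent_subset_D\<close>), because expanding the distance to \<open>D\<close>
  over and over keeps it bounded. The return property is open, so finitely many digit strings suffice for
  all points of \<open>K\<close> and all parameters of the rectangle; they are arranged along a subdivision
  of \<open>K\<close> into triangles and, where it is needed, of the rectangle. Likewise \<open>K\<close>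
  has interior, so a digit string that carries \<open>(1, 1)\<close> into \<open>K\<close> does so for a
  whole interval of parameters, and finitely many strings cover the boundary of the rectangle.

  The boundary is then a loop in the locus with winding number 1 around a point outside the locus,
  and such a loop cannot be contracted inside the locus (\<open>not_simply_connected_if_rectangle\<close>).

  The subdivision and the digit strings were found by a computer search; here they are only checked,
  in integer interval arithmetic with rounding at \<open>2\<^sup>-\<^sup>3\<^sup>2\<close>.
\<close>

section \<open>Digit expansions and the difference set of the attractor\<close>

datatype digit = Minus | Zero | Plus

primrec digit_val :: "digit \<Rightarrow> int" where
  "digit_val Minus = -1"
| "digit_val Zero = 0"
| "digit_val Plus = 1"

definition expand :: "real \<Rightarrow> real \<Rightarrow> digit \<Rightarrow> real \<times> real \<Rightarrow> real \<times> real" where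
  "expand b1 b2 d v = (b1 * fst v + digit_val d, b2 * snd v + digit_val d)"

fun run :: "real \<Rightarrow> real \<Rightarrow> digit list \<Rightarrow> real \<times> real \<Rightarrow> real \<times> real" where
  "run b1 b2 [] v = v"
| "run b1 b2 (d # w) v = run b1 b2 w (expand b1 b2 d v)"

definition half_differences :: "(real \<times> real) set \<Rightarrow> (real \<times> real) set" where
  "half_differences A = (\<lambda>(x, y). (1/2) *\<^sub>R (y - x)) ` (A \<times> A)"

lemma half_differencesI:
  assumes "x \<in> A" "y \<in> A" "y - x = 2 *\<^sub>R v"
  shows "v \<in> half_differences A"
proof -
  have "v = (1/2) *\<^sub>R (y - x)" using assms(3) by simp
  then show ?thesis unfolding half_differences_def using assms(1,2) by force
qed

lemma half_differencesE:
  assumes "v \<in> half_differences A"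
  obtains x y where "x \<in> A" "y \<in> A" "y - x = 2 *\<^sub>R v"
  using assms unfolding half_differences_def by auto

text \<open>The preimages of a common point of the two pieces differ by exactly \<open>(2, 2)\<close>.\<close>

lemma attractor_pieces_meet_iff:
  assumes "1 < b1" "1 < b2"
  shows "affT b1 b2 1 ` A \<inter> affT b1 b2 (-1) ` A \<noteq> {} \<longleftrightarrow> (1, 1) \<in> half_differences A"
proof -
  have eq: "affT b1 b2 1 x = affT b1 b2 (-1) y \<longleftrightarrow> y - x = 2 *\<^sub>R (1, 1)" for x y
    using assms by (auto simp: affT_def prod_eq_iff field_simps)
  show ?thesis
  proof
    assume "affT b1 b2 1 ` A \<inter> affT b1 b2 (-1) ` A \<noteq> {}"
    then obtain x y where "x \<in> A" "y \<in> A" "affT b1 b2 1 x = affT b1 b2 (-1) y" by force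
    then show "(1, 1) \<in> half_differences A" using eq half_differencesI by blast
  next
    assume "(1, 1) \<in> half_differences A"
    then obtain x y where "x \<in> A" "y \<in> A" "y - x = 2 *\<^sub>R (1, 1)" by (rule half_differencesE)
    then show "affT b1 b2 1 ` A \<inter> affT b1 b2 (-1) ` A \<noteq> {}" using eq by blast
  qed
qed

locale attractor_pair =
  fixes b1 b2 :: real and A :: "(real \<times> real) set"
  assumes b1: "1 < b1" and b2: "1 < b2" and attractor: "is_attractor b1 b2 A"
begin

lemma A_nonempty: "A \<noteq> {}" and A_compact: "compact A"
  and A_eq: "A = affT b1 b2 1 ` A \<union> affT b1 b2 (-1) ` A"
  using attractor unfolding is_attractor_def by blast+

lemma affT_in_A: "x \<in> A \<Longrightarrow> i = 1 \<or> i = -1 \<Longrightarrow> affT b1 b2 i x \<in> A"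
  using A_eq by blast

lemma A_cases:
  assumes "x \<in> A"
  obtains i x' where "i = 1 \<or> i = -1" "x' \<in> A" "x = affT b1 b2 i x'"
  using assms A_eq by blast

abbreviation "D \<equiv> half_differences A"

lemma D_compact: "compact D"
  unfolding half_differences_def case_prod_beta
  by (intro compact_continuous_image compact_Times A_compact continuous_intros)

lemma D_nonempty: "D \<noteq> {}"
  unfolding half_differences_def using A_nonempty by auto

lemma expand_affT:
  assumes "y' - x' = 2 *\<^sub>R expand b1 b2 d v" "2 * real_of_int (digit_val d) = j - i"
  shows "affT b1 b2 i y' - affT b1 b2 j x' = 2 *\<^sub>R v"
  using assms b1 b2 by (auto simp: affT_def expand_def prod_eq_iff field_simps)

text \<open>Halving the differences makes their digits \<open>-1, 0, 1\<close> instead of \<open>-2, 0, 2\<close>; the next two lemmas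
  together say that \<open>D\<close> is the attractor of the system with these three digits.\<close>

lemma D_expand:
  assumes "v \<in> D"
  shows "\<exists>d. expand b1 b2 d v \<in> D"
proof -
  obtain x y where xy: "x \<in> A" "y \<in> A" "y - x = 2 *\<^sub>R v" using assms by (rule half_differencesE)
  obtain i y' where y': "i = 1 \<or> i = -1" "y' \<in> A" "y = affT b1 b2 i y'" using A_cases[OF xy(2)] .
  obtain j x' where x': "j = 1 \<or> j = -1" "x' \<in> A" "x = affT b1 b2 j x'" using A_cases[OF xy(1)] .
  have "2 * real_of_int (digit_val (if i = j then Zero else if i = 1 then Minus else Plus)) = j - i"
    using x'(1) y'(1) by auto
  then obtain d where d: "2 * real_of_int (digit_val d) = j - i" by blast
  have "y' - x' = 2 *\<^sub>R expand b1 b2 d v"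
  proof -
    have "b1 * ((fst y' + i) / b1 - (fst x' + j) / b1) = b1 * (2 * fst v)"
      "b2 * ((snd y' + i) / b2 - (snd x' + j) / b2) = b2 * (2 * snd v)"
      using xy(3) unfolding x'(3) y'(3) affT_def prod_eq_iff by simp_all
    then show ?thesis
      using d b1 b2 by (auto simp: expand_def prod_eq_iff right_diff_distrib)
  qed
  then show ?thesis using half_differencesI x'(2) y'(2) by blast
qed

lemma D_pull:
  assumes "expand b1 b2 d v \<in> D"
  shows "v \<in> D"
proof -
  obtain x y where xy: "x \<in> A" "y \<in> A" "y - x = 2 *\<^sub>R expand b1 b2 d v"
    using assms by (rule half_differencesE)
  \<comment> \<open>Each digit is half of a difference \<open>j - i\<close> with \<open>i\<close> and \<open>j\<close> among \<open>1, -1\<close>.\<close>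
  define i :: real where "i = (if d = Plus then -1 else 1)"
  define j :: real where "j = (if d = Minus then -1 else 1)"
  have "affT b1 b2 i y - affT b1 b2 j x = 2 *\<^sub>R v"
    by (rule expand_affT[OF xy(3)]) (cases d; simp add: i_def j_def)
  moreover have "affT b1 b2 i y \<in> A" "affT b1 b2 j x \<in> A"
    by (auto intro!: affT_in_A xy simp: i_def j_def)
  ultimately show ?thesis using half_differencesI by blast
qed

lemma run_pull: "run b1 b2 w v \<in> D \<Longrightarrow> v \<in> D"
  
proof (induction w arbitrary: v)
  case (Cons d w)
  then show ?case using D_pull[of d v] by simp
qed simp

text \<open>From a point of \<open>D\<close> where the coordinate is largest in absolute value, some expansion stays in \<open>D\<close>
  and so cannot enlarge it.\<close>

lemma fst_D: assumes "v \<in> D" shows "\<bar>fst v\<bar> \<le> 1 / (b1 - 1)"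
proof -
  have "continuous_on D (\<lambda>v. \<bar>fst v\<bar>)" by (intro continuous_intros)
  from continuous_attains_sup[OF D_compact D_nonempty this]
  obtain u where u: "u \<in> D" "\<And>y. y \<in> D \<Longrightarrow> \<bar>fst y\<bar> \<le> \<bar>fst u\<bar>" by blast
  obtain d where d: "expand b1 b2 d u \<in> D" using D_expand[OF u(1)] ..
  have "\<bar>b1 * fst u + digit_val d\<bar> \<le> \<bar>fst u\<bar>" using u(2)[OF d] by (simp add: expand_def)
  moreover have "\<bar>b1 * fst u\<bar> = b1 * \<bar>fst u\<bar>" using b1 by (simp add: abs_mult)
  moreover have "\<bar>real_of_int (digit_val d)\<bar> \<le> 1" by (cases d) auto
  ultimately have "b1 * \<bar>fst u\<bar> \<le> \<bar>fst u\<bar> + 1" by linarith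
  then have "\<bar>fst u\<bar> \<le> 1 / (b1 - 1)" using b1 by (simp add: field_simps)
  then show ?thesis using u(2)[OF assms] by linarith
qed

lemma snd_D: assumes "v \<in> D" shows "\<bar>snd v\<bar> \<le> 1 / (b2 - 1)"
proof -
  have "continuous_on D (\<lambda>v. \<bar>snd v\<bar>)" by (intro continuous_intros)
  from continuous_attains_sup[OF D_compact D_nonempty this]
  obtain u where u: "u \<in> D" "\<And>y. y \<in> D \<Longrightarrow> \<bar>snd y\<bar> \<le> \<bar>snd u\<bar>" by blast
  obtain d where d: "expand b1 b2 d u \<in> D" using D_expand[OF u(1)] ..
  have "\<bar>b2 * snd u + digit_val d\<bar> \<le> \<bar>snd u\<bar>" using u(2)[OF d] by (simp add: expand_def)
  moreover have "\<bar>b2 * snd u\<bar> = b2 * \<bar>snd u\<bar>" using b2 by (simp add: abs_mult)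
  moreover have "\<bar>real_of_int (digit_val d)\<bar> \<le> 1" by (cases d) auto
  ultimately have "b2 * \<bar>snd u\<bar> \<le> \<bar>snd u\<bar> + 1" by linarith
  then have "\<bar>snd u\<bar> \<le> 1 / (b2 - 1)" using b2 by (simp add: field_simps)
  then show ?thesis using u(2)[OF assms] by linarith
qed

text \<open>\<open>D\<close> contains all preimages of its points, and these preimages are contracted.\<close>

lemma infdist_expand:
  "min b1 b2 * infdist v D \<le> infdist (expand b1 b2 d v) D"
proof -
  obtain c where c: "c \<in> D" "infdist (expand b1 b2 d v) D = dist (expand b1 b2 d v) c"
    using infdist_attains_inf[OF compact_imp_closed[OF D_compact] D_nonempty] by blast
  \<comment> \<open>The preimage of the point of \<open>D\<close> nearest to the expanded vector.\<close>
  define u where "u = ((fst c - digit_val d) / b1, (snd c - digit_val d) / b2)"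
  have u: "expand b1 b2 d u = c" using b1 b2 by (simp add: expand_def u_def)
  then have "infdist v D \<le> dist v u" using c(1) D_pull[of d u] by (intro infdist_le) simp
  then have "min b1 b2 * infdist v D \<le> min b1 b2 * dist v u"
    using b1 b2 by (intro mult_left_mono) auto
  also have "\<dots> = sqrt ((min b1 b2 * dist (fst v) (fst u))\<^sup>2 + (min b1 b2 * dist (snd v) (snd u))\<^sup>2)"
  proof -
    have "sqrt ((min b1 b2 * dist (fst v) (fst u))\<^sup>2 + (min b1 b2 * dist (snd v) (snd u))\<^sup>2)
        = sqrt ((min b1 b2)\<^sup>2 * ((dist (fst v) (fst u))\<^sup>2 + (dist (snd v) (snd u))\<^sup>2))"
      by (simp add: power_mult_distrib algebra_simps)
    then show ?thesis using b1 b2 by (simp add: real_sqrt_mult dist_prod_def)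
  qed
  also have "\<dots> \<le> sqrt ((b1 * dist (fst v) (fst u))\<^sup>2 + (b2 * dist (snd v) (snd u))\<^sup>2)"
    using b1 b2 by (intro real_sqrt_le_mono add_mono power_mono mult_right_mono) auto
  also have "\<dots> = dist (expand b1 b2 d v) (expand b1 b2 d u)"
    using b1 b2 by (simp add: expand_def dist_prod_def dist_real_def abs_mult power_mult_distrib
        flip: right_diff_distrib)
  finally show ?thesis unfolding c(2) u .
qed

lemma infdist_run: "min b1 b2 ^ length w * infdist v D \<le> infdist (run b1 b2 w v) D"
proof (induction w arbitrary: v)
  case (Cons d w)
  have "min b1 b2 ^ length (d # w) * infdist v D = min b1 b2 ^ length w * (min b1 b2 * infdist v D)"
    by simp
  also have "\<dots> \<le> min b1 b2 ^ length w * infdist (expand b1 b2 d v) D"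
    using b1 b2 by (intro mult_left_mono infdist_expand) auto
  also have "\<dots> \<le> infdist (run b1 b2 (d # w) v) D" using Cons.IH by simp
  finally show ?case .
qed simp

text \<open>Each return to \<open>K\<close> multiplies the distance to \<open>D\<close> by at least \<open>min b1 b2 > 1\<close>, yet the distance
  stays bounded on \<open>K\<close>; so it was zero from the start.\<close>

lemma recurrent_subset_D:
  assumes "bounded K"
    and ret: "\<And>v. v \<in> K \<Longrightarrow> \<exists>w. w \<noteq> [] \<and> run b1 b2 w v \<in> K"
  shows "K \<subseteq> D"
proof
  fix v assume "v \<in> K"
  define m where "m = min b1 b2"
  have m: "1 < m" using b1 b2 by (simp add: m_def)
  obtain c where c: "c \<in> D" using D_nonempty by blast
  obtain R where R: "\<And>u. u \<in> K \<Longrightarrow> dist c u \<le> R"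
    using \<open>bounded K\<close> bounded_any_center[of K c] by blast
  have bound: "infdist u D \<le> R" if "u \<in> K" for u
    using R[OF that] infdist_le[OF c, of u] by (simp add: dist_commute)
  have decay: "m ^ n * infdist u D \<le> R" if "u \<in> K" for n u
    using that
  proof (induction n arbitrary: u)
    case 0 then show ?case using bound by simp
  next
    case (Suc n)
    obtain w where w: "w \<noteq> []" "run b1 b2 w u \<in> K" using ret[OF Suc.prems] by blast
    have "m \<le> m ^ length w" using m w(1) by (cases w) auto
    then have "m * infdist u D \<le> m ^ length w * infdist u D"
      by (intro mult_right_mono infdist_nonneg)
    also have "\<dots> \<le> infdist (run b1 b2 w u) D" unfolding m_def by (rule infdist_run)
    finally have "m ^ n * (m * infdist u D) \<le> m ^ n * infdist (run b1 b2 w u) D"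
      using m by (intro mult_left_mono) auto
    also have "\<dots> \<le> R" by (rule Suc.IH[OF w(2)])
    finally show ?case by (simp add: mult_ac)
  qed
  have "infdist v D = 0"
  proof (rule ccontr)
    assume "infdist v D \<noteq> 0"
    then have pos: "0 < infdist v D" using infdist_nonneg[of v D] by linarith
    obtain n where "R / infdist v D < m ^ n" using real_arch_pow[OF m] by blast
    then have "R < m ^ n * infdist v D" using pos by (simp add: field_simps)
    then show False using decay[OF \<open>v \<in> K\<close>, of n] by linarith
  qed
  then show "v \<in> D"
    using in_closed_iff_infdist_zero[OF compact_imp_closed[OF D_compact] D_nonempty] by blast
qed

end

section \<open>The attractor is connected or totally disconnected\<close>

context attractor_pair
begin

lemma continuous_on_affT: "continuous_on X (affT b1 b2 i)"
  unfolding affT_def using b1 b2 by (intro continuous_intros) auto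

text \<open>Starting from the convex hull of the attractor, the iterates of the two maps form a decreasing
  sequence of compact sets. They stay connected because the pieces of the attractor, and hence the
  pieces of every iterate, meet; they shrink to the attractor because the maps are contractions.\<close>

lemma connected_if_pieces_meet:
  assumes meet: "affT b1 b2 1 ` A \<inter> affT b1 b2 (-1) ` A \<noteq> {}"
  shows "connected A"
proof -
  define r where "r = max (1/b1) (1/b2)"
  have r: "0 \<le> r" "r < 1" using b1 b2 by (auto simp: r_def le_max_iff_disj)
  define F where "F X = affT b1 b2 1 ` X \<union> affT b1 b2 (-1) ` X" for X
  define K where "K n = (F ^^ n) (convex hull A)" for n
  have K_Suc: "K (Suc n) = F (K n)" for n by (simp add: K_def)
  have F_mono: "F X \<subseteq> F Y" if "X \<subseteq> Y" for X Y using that by (auto simp: F_def)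
  have FA: "F A = A" using A_eq by (simp add: F_def)
  have AK: "A \<subseteq> K n" for n
  proof (induction n)
    case 0 show ?case by (simp add: K_def hull_subset)
  next
    case (Suc n) then show ?case using F_mono[of A "K n"] by (simp add: K_Suc FA)
  qed
  have comp: "compact (K n)" for n
  proof (induction n)
    case 0 show ?case by (simp add: K_def compact_convex_hull A_compact)
  next
    case (Suc n) then show ?case
      unfolding K_Suc F_def by (intro compact_Un compact_continuous_image continuous_on_affT)
  qed
  have conn: "connected (K n)" for n
  proof (induction n)
    case 0 show ?case by (simp add: K_def convex_connected)
  next
    case (Suc n)
    have "affT b1 b2 1 ` K n \<inter> affT b1 b2 (-1) ` K n \<noteq> {}" using meet AK[of n] by blast
    then show ?case unfolding K_Suc F_def
      using Suc by (intro connected_Un connected_continuous_image continuous_on_affT)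
  qed
  have affT_hull: "affT b1 b2 i ` (convex hull A) \<subseteq> convex hull A" if i: "i = 1 \<or> i = -1" for i
  proof -
    have "affT b1 b2 i (u *\<^sub>R x + v *\<^sub>R y) = u *\<^sub>R affT b1 b2 i x + v *\<^sub>R affT b1 b2 i y"
      if "u + v = 1" for u v x y
    proof -
      have "v = 1 - u" using that by simp
      then show ?thesis
        using b1 b2 unfolding \<open>v = 1 - u\<close> by (simp add: affT_def prod_eq_iff field_simps)
    qed
    then have "convex (affT b1 b2 i -` (convex hull A))"
      using convex_convex_hull[of A] unfolding convex_def by simp
    moreover have "A \<subseteq> affT b1 b2 i -` (convex hull A)"
      using affT_in_A i hull_subset[of A convex] by blast
    ultimately have "convex hull A \<subseteq> affT b1 b2 i -` (convex hull A)" by (rule hull_minimal[rotated])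
    then show ?thesis by blast
  qed
  have dec: "K (Suc n) \<subseteq> K n" for n
  proof (induction n)
    case 0 show ?case using affT_hull[of 1] affT_hull[of "-1"] by (simp add: K_def F_def)
  next
    case (Suc n) then show ?case by (metis F_mono K_Suc)
  qed
  have anti: "K n \<subseteq> K m" if "m \<le> n" for m n
    using dec lift_Suc_antimono_le[of K, OF _ that] by blast
  obtain R where R: "\<And>x. x \<in> convex hull A \<Longrightarrow> infdist x A \<le> R"
  proof -
    have "continuous_on (convex hull A) (\<lambda>x. infdist x A)" by (intro continuous_intros)
    then obtain u where "\<And>x. x \<in> convex hull A \<Longrightarrow> infdist x A \<le> infdist u A"
      using continuous_attains_sup[of "convex hull A" "\<lambda>x. infdist x A"]
        compact_convex_hull[OF A_compact] A_nonempty by auto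
    then show ?thesis using that by blast
  qed
  have close: "infdist x A \<le> r ^ n * R" if "x \<in> K n" for n x
    using that
  proof (induction n arbitrary: x)
    case 0 then show ?case using R by (simp add: K_def)
  next
    case (Suc n)
    then obtain i y where iy: "i = 1 \<or> i = -1" "y \<in> K n" "x = affT b1 b2 i y"
      unfolding K_Suc F_def by blast
    obtain c where c: "c \<in> A" "infdist y A = dist y c"
      using infdist_attains_inf[OF compact_imp_closed[OF A_compact] A_nonempty] by blast
    have "infdist x A \<le> dist (affT b1 b2 i y) (affT b1 b2 i c)"
      unfolding iy(3) by (rule infdist_le[OF affT_in_A[OF c(1) iy(1)]])
    also have "\<dots> \<le> r * dist y c" unfolding r_def by (rule affT_dist_le[OF b1 b2])
    also have "\<dots> \<le> r * (r ^ n * R)" using Suc.IH[OF iy(2)] c(2) r by (intro mult_left_mono) auto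
    finally show ?case by (simp add: mult_ac)
  qed
  have "(\<Inter>(range K)) \<subseteq> A"
  proof
    fix x assume x: "x \<in> \<Inter>(range K)"
    have "(\<lambda>n. r ^ n * R) \<longlonglongrightarrow> 0 * R" using r by (intro tendsto_intros LIMSEQ_power_zero) auto
    moreover have "\<forall>n. infdist x A \<le> r ^ n * R" using x close by blast
    ultimately have "infdist x A \<le> 0" using LIMSEQ_le_const by fastforce
    then have "infdist x A = 0" using infdist_nonneg[of x A] by linarith
    then show "x \<in> A"
      using in_closed_iff_infdist_zero[OF compact_imp_closed[OF A_compact] A_nonempty] by blast
  qed
  then have "A = \<Inter>(range K)" using AK by blast
  then show ?thesis using connected_nest[of K, OF comp conn anti] by simp
qed

text \<open>A connected subset lies in one of two disjoint compact pieces; undoing that map gives a connected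
  subset again, so its diameter is at most any power of the contraction ratio times that of \<open>A\<close>.\<close>

lemma totally_disconnected_if_pieces_disjoint:
  assumes disj: "affT b1 b2 1 ` A \<inter> affT b1 b2 (-1) ` A = {}"
  shows "totally_disconnected A"
proof -
  define r where "r = max (1/b1) (1/b2)"
  have r: "0 \<le> r" "r < 1" using b1 b2 by (auto simp: r_def le_max_iff_disj)
  obtain R where R: "\<And>x y. x \<in> A \<Longrightarrow> y \<in> A \<Longrightarrow> dist x y \<le> R"
    using compact_imp_bounded[OF A_compact] unfolding bounded_two_points by blast
  have small: "dist x y \<le> r ^ n * R" if "connected C" "C \<subseteq> A" "x \<in> C" "y \<in> C" for n C x y
    using that
  proof (induction n arbitrary: C x y)
    case 0
    then have "x \<in> A" "y \<in> A" by blast+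
    then show ?case using R by simp
  next
    case (Suc n)
    have closed: "closed (affT b1 b2 i ` A)" for i
      by (intro compact_imp_closed compact_continuous_image continuous_on_affT A_compact)
    have "affT b1 b2 1 ` A \<inter> C = {} \<or> affT b1 b2 (-1) ` A \<inter> C = {}"
      using connected_closedD[OF Suc.prems(1) _ _ closed[of 1] closed[of "-1"]] disj Suc.prems(2) A_eq
      by blast
    then obtain i where i: "i = 1 \<or> i = -1" "C \<subseteq> affT b1 b2 i ` A"
      using Suc.prems(2) A_eq by blast
    define g where "g p = (b1 * fst p - i, b2 * snd p - i)" for p :: "real \<times> real"
    have g: "g (affT b1 b2 i p) = p" for p using b1 b2 by (simp add: g_def affT_def)
    have "connected (g ` C)" unfolding g_def
      by (intro connected_continuous_image continuous_intros Suc.prems(1))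
    moreover have "g ` C \<subseteq> A" using i(2) g by force
    ultimately have IH: "dist (g x) (g y) \<le> r ^ n * R" using Suc.IH Suc.prems(3,4) by blast
    have "x = affT b1 b2 i (g x)" "y = affT b1 b2 i (g y)"
      using b1 b2 by (simp_all add: g_def affT_def)
    then have "dist x y \<le> r * dist (g x) (g y)"
      unfolding r_def using affT_dist_le[OF b1 b2] by metis
    also have "\<dots> \<le> r * (r ^ n * R)" using IH r by (intro mult_left_mono) auto
    finally show ?case by (simp add: mult_ac)
  qed
  show ?thesis unfolding totally_disconnected_def
  proof (intro allI impI ballI)
    fix C x y assume C: "C \<subseteq> A \<and> connected C" "x \<in> C" "y \<in> C"
    have "(\<lambda>n. r ^ n * R) \<longlonglongrightarrow> 0 * R" using r by (intro tendsto_intros LIMSEQ_power_zero) auto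
    moreover have "\<forall>n. dist x y \<le> r ^ n * R" using small C by blast
    ultimately have "dist x y \<le> 0" using LIMSEQ_le_const by fastforce
    then show "x = y" by simp
  qed
qed

text \<open>Both properties together would make the attractor a single point, whose two images differ.\<close>

lemma not_connected_and_totally_disconnected:
  "\<not> (connected A \<and> totally_disconnected A)"
proof
  assume *: "connected A \<and> totally_disconnected A"
  obtain x where x: "x \<in> A" using A_nonempty by blast
  have "affT b1 b2 1 x = affT b1 b2 (-1) x"
    using * affT_in_A[OF x] unfolding totally_disconnected_def by blast
  then show False using b1 by (simp add: affT_def divide_right_mono field_simps)
qed

lemma connected_iff: "connected A \<longleftrightarrow> (1, 1) \<in> D"
  using attractor_pieces_meet_iff[OF b1 b2] connected_if_pieces_meet
    totally_disconnected_if_pieces_disjoint not_connected_and_totally_disconnected by blast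

lemma totally_disconnected_iff: "totally_disconnected A \<longleftrightarrow> \<not> connected A"
  using connected_if_pieces_meet totally_disconnected_if_pieces_disjoint
    not_connected_and_totally_disconnected by blast

end

lemma attractor_pair_attractor:
  "1 < b1 \<Longrightarrow> 1 < b2 \<Longrightarrow> attractor_pair b1 b2 (attractor b1 b2)"
  by (simp add: attractor_pair_def is_attractor_attractor)

lemma connectedness_locus_eq:
  "connectedness_locus = ({1<..} \<times> {1<..}) - disconnectedness_locus"
  unfolding connectedness_locus_def disconnectedness_locus_def
  using attractor_pair.totally_disconnected_iff[OF attractor_pair_attractor] by auto

section \<open>A loop around a missing point\<close>

text \<open>Read in the complex plane, the boundary of the rectangle has winding number 1 around the missing
  point, whereas a contraction of it inside \<open>S\<close> would avoid that point and give winding number 0.\<close>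

lemma not_simply_connected_if_rectangle:
  fixes S :: "(real \<times> real) set"
  assumes lr: "l \<le> r" "b \<le> t"
    and p: "l < px" "px < r" "b < py" "py < t" "(px, py) \<notin> S"
    and vertical: "\<And>y. b \<le> y \<Longrightarrow> y \<le> t \<Longrightarrow> (l, y) \<in> S \<and> (r, y) \<in> S"
    and horizontal: "\<And>x. l \<le> x \<Longrightarrow> x \<le> r \<Longrightarrow> (x, b) \<in> S \<and> (x, t) \<in> S"
  shows "\<not> simply_connected S"
proof
  assume sc: "simply_connected S"
  define f where "f v = Complex (fst v) (snd v)" for v
  define g where "g z = (Re z, Im z)" for z
  define \<gamma> where "\<gamma> = rectpath (Complex l b) (Complex r t)"
  define z where "z = Complex px py"
  have fg: "f (g w) = w" and gf: "g (f v) = v" for v w by (auto simp: f_def g_def)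
  have cont_g: "continuous_on X g" for X unfolding g_def by (intro continuous_intros)
  have cont_f: "continuous_on X f" for X
    unfolding f_def Complex_eq by (intro continuous_intros)
  have img: "path_image \<gamma> = cbox (Complex l b) (Complex r t) - box (Complex l b) (Complex r t)"
    unfolding \<gamma>_def using lr by (intro path_image_rectpath_cbox_minus_box) auto
  have "g w \<in> S" if w: "w \<in> path_image \<gamma>" for w
  proof -
    have "l \<le> Re w" "Re w \<le> r" "b \<le> Im w" "Im w \<le> t"
      "Re w = l \<or> Re w = r \<or> Im w = b \<or> Im w = t"
      using w unfolding img in_cbox_complex_iff Diff_iff in_box_complex_iff by auto
    then show ?thesis using vertical[of "Im w"] horizontal[of "Re w"] by (auto simp: g_def)
  qed
  then have sub: "path_image (g \<circ> \<gamma>) \<subseteq> S" by (auto simp: path_image_compose)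
  have path: "path (g \<circ> \<gamma>)" unfolding \<gamma>_def by (intro path_continuous_image cont_g path_rectpath)
  have loop: "pathfinish (g \<circ> \<gamma>) = pathstart (g \<circ> \<gamma>)"
    by (simp add: pathfinish_compose pathstart_compose \<gamma>_def)
  define c where "c = pathstart (g \<circ> \<gamma>)"
  have "homotopic_loops S (g \<circ> \<gamma>) (linepath c c)"
    using sc path loop sub pathstart_in_path_image[of "g \<circ> \<gamma>"]
    unfolding simply_connected_eq_contractible_loop_any c_def by blast
  then have "homotopic_loops (-{z}) (f \<circ> (g \<circ> \<gamma>)) (f \<circ> linepath c c)"
  proof (rule homotopic_loops_continuous_image[OF _ cont_f])
    show "f \<in> S \<rightarrow> - {z}"
      using p(5) by (auto simp: f_def z_def)
  qed
  moreover have "f \<circ> (g \<circ> \<gamma>) = \<gamma>" by (simp add: fun_eq_iff fg)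
  ultimately have "winding_number \<gamma> z = winding_number (f \<circ> linepath c c) z"
    using winding_number_homotopic_loops by metis
  also have "\<dots> = 0"
  proof (rule winding_number_constI)
    have "c \<in> S" unfolding c_def using sub pathstart_in_path_image by blast
    then show "f c \<noteq> z" using p(5) by (auto simp: f_def z_def)
  qed (simp add: linepath_def flip: scaleR_left_distrib)
  finally have "winding_number \<gamma> z = 0" .
  moreover have "winding_number \<gamma> z = 1"
    unfolding \<gamma>_def z_def using p by (intro winding_number_rectpath) (simp add: in_box_complex_iff)
  ultimately show False by simp
qed

section \<open>Rounded interval arithmetic\<close>

text \<open>Reals are enclosed by intervals of integers in units of \<open>2\<^sup>-\<^sup>3\<^sup>2\<close>.\<close>

abbreviation (input) scale :: "'a::numeral" where "scale \<equiv> 4294967296"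

text \<open>Halving reads off the binary digits of a numeral, which is much cheaper in symbolic evaluation than
  the general division algorithm; rounding after a multiplication is a repeated halving.\<close>

definition half :: "int \<Rightarrow> int" where "half x = x div 2"

lemma half_code [code]:
  "half 0 = 0"
  "half (Int.Pos num.One) = 0"
  "half (Int.Pos (num.Bit0 n)) = Int.Pos n"
  "half (Int.Pos (num.Bit1 n)) = Int.Pos n"
  "half (Int.Neg num.One) = Int.Neg num.One"
  "half (Int.Neg (num.Bit0 n)) = Int.Neg n"
  "half (Int.Neg (num.Bit1 n)) = Int.Neg (Num.inc n)"
proof -
  have num: "(- numeral (num.Bit1 n) :: int) = 2 * - numeral (Num.inc n) + 1"
  proof -
    have "- (k + k + 1) = 2 * - (k + 1) + 1" for k :: int by simp
    then show ?thesis unfolding numeral_inc numeral_Bit1 .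
  qed
  show "half (Int.Neg (num.Bit1 n)) = Int.Neg (Num.inc n)"
  proof -
    have "(2 * k + 1) div 2 = k" for k :: int by simp
    then show ?thesis unfolding half_def Int.Neg_def Int.Pos_def num .
  qed
  show "half (Int.Neg (num.Bit0 n)) = Int.Neg n"
    unfolding half_def Int.Neg_def numeral_Bit0 by simp
qed (simp_all add: half_def)

definition half8 :: "int \<Rightarrow> int" where
  "half8 x = half (half (half (half (half (half (half (half x)))))))"

definition shift :: "int \<Rightarrow> int" where "shift x = half8 (half8 (half8 (half8 x)))"

lemma shift_eq: "shift x = x div scale"
  by (simp add: shift_def half8_def half_def div_mult2_eq[symmetric] zdiv_zmult2_eq[symmetric])

type_synonym ival = "int \<times> int"

definition encloses :: "ival \<Rightarrow> real \<Rightarrow> bool" where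
  "encloses I x \<longleftrightarrow> fst I \<le> x * scale \<and> x * scale \<le> snd I"

definition encloses2 :: "ival \<times> ival \<Rightarrow> real \<times> real \<Rightarrow> bool" where
  "encloses2 B v \<longleftrightarrow> encloses (fst B) (fst v) \<and> encloses (snd B) (snd v)"

text \<open>Outward rounded bounds of the product with a non-negative number from the interval \<open>B\<close>. Which end
  of \<open>B\<close> is the extreme one depends on the sign of the other factor; rounding is downwards, and adding
  1 turns it into rounding upwards.\<close>

definition mul_lo :: "ival \<Rightarrow> int \<Rightarrow> int" where
  "mul_lo B l = shift (if 0 \<le> l then fst B * l else snd B * l)"

definition mul_hi :: "ival \<Rightarrow> int \<Rightarrow> int" where
  "mul_hi B h = shift (if 0 \<le> h then snd B * h else fst B * h) + 1"

primrec digit_fix :: "digit \<Rightarrow> int" where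
  "digit_fix Minus = -4294967296"
| "digit_fix Zero = 0"
| "digit_fix Plus = 4294967296"

fun expand_ival :: "ival \<Rightarrow> digit \<Rightarrow> ival \<Rightarrow> ival" where
  "expand_ival B d (l, h) = (mul_lo B l + digit_fix d, mul_hi B h + digit_fix d)"

fun expand_box :: "ival \<Rightarrow> ival \<Rightarrow> digit \<Rightarrow> ival \<times> ival \<Rightarrow> ival \<times> ival" where
  "expand_box B1 B2 d (I, J) = (expand_ival B1 d I, expand_ival B2 d J)"

lemma digit_fix: "digit_fix d = digit_val d * scale"
  by (cases d) auto

lemma shift_bounds: "real_of_int (shift x) * scale \<le> x" "x \<le> (real_of_int (shift x) + 1) * scale"
proof -
  have "scale * (x div scale) + x mod scale = x" "0 \<le> x mod scale" "x mod scale < scale"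
    by simp_all
  then have "shift x * scale \<le> x" "x \<le> (shift x + 1) * scale" unfolding shift_eq by (simp_all add: algebra_simps)
  then have "real_of_int (shift x * scale) \<le> x" "x \<le> real_of_int ((shift x + 1) * scale)"
    by (simp_all only: of_int_le_iff)
  then show "real_of_int (shift x) * scale \<le> x" "x \<le> (real_of_int (shift x) + 1) * scale"
    by simp_all
qed

lemma mul_lo:
  assumes "0 \<le> b" "encloses B b" "of_int l \<le> x * scale"
  shows "of_int (mul_lo B l) \<le> b * x * scale"
proof -
  have "of_int (if 0 \<le> l then fst B * l else snd B * l) \<le> (b * scale) * of_int l"
    using assms(2) by (auto simp: encloses_def intro: mult_right_mono mult_right_mono_neg)
  also have "\<dots> \<le> (b * scale) * (x * scale)"
    using assms(1,3) by (intro mult_left_mono) auto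
  finally have "of_int (mul_lo B l) * scale \<le> (b * scale) * (x * scale)"
    unfolding mul_lo_def using shift_bounds(1) order_trans by blast
  then show ?thesis by simp
qed

lemma mul_hi:
  assumes "0 \<le> b" "encloses B b" "x * scale \<le> of_int h"
  shows "b * x * scale \<le> of_int (mul_hi B h)"
proof -
  have "(b * scale) * (x * scale) \<le> (b * scale) * of_int h"
    using assms(1,3) by (intro mult_left_mono) auto
  also have "\<dots> \<le> of_int (if 0 \<le> h then snd B * h else fst B * h)"
    using assms(2) by (auto simp: encloses_def intro: mult_right_mono mult_right_mono_neg)
  finally have "(b * scale) * (x * scale) \<le> of_int (mul_hi B h) * scale"
    unfolding mul_hi_def of_int_add of_int_1 using shift_bounds(2) order_trans by blast
  then show ?thesis by simp
qed

lemma expand_ival: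
  assumes "0 \<le> b" "encloses B b" "encloses I x"
  shows "encloses (expand_ival B d I) (b * x + digit_val d)"
  using mul_lo[OF assms(1,2), of "fst I" x] mul_hi[OF assms(1,2), of x "snd I"] assms(3)
  by (cases I) (auto simp: encloses_def digit_fix algebra_simps)

lemma expand_box:
  assumes "0 \<le> b1" "0 \<le> b2" "encloses B1 b1" "encloses B2 b2" "encloses2 X v"
  shows "encloses2 (expand_box B1 B2 d X) (expand b1 b2 d v)"
  using expand_ival[OF assms(1,3), of "fst X" "fst v" d] expand_ival[OF assms(2,4), of "snd X" "snd v" d]
    assms(5) by (cases X) (simp add: encloses2_def expand_def)

fun run_box :: "ival \<Rightarrow> ival \<Rightarrow> digit list \<Rightarrow> ival \<times> ival \<Rightarrow> ival \<times> ival" where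
  "run_box B1 B2 [] X = X"
| "run_box B1 B2 (d # w) X = run_box B1 B2 w (expand_box B1 B2 d X)"

lemma run_box:
  assumes "0 \<le> b1" "0 \<le> b2" "encloses B1 b1" "encloses B2 b2" "encloses2 X v"
  shows "encloses2 (run_box B1 B2 w X) (run b1 b2 w v)"
  using assms(5)
proof (induction w arbitrary: X v)
  case (Cons d w)
  then show ?case using Cons.IH[OF expand_box[OF assms(1-4) Cons.prems]] by simp
qed simp

section \<open>Polygons whose points return\<close>

text \<open>A centrally symmetric convex polygon is an intersection of strips, one for each pair of opposite
  edges: the edge direction \<open>(x, y)\<close> and half the width \<open>d\<close>, measured by the cross product.\<close>

type_synonym strip = "int \<times> int \<times> int"

definition polygon :: "strip list \<Rightarrow> (real \<times> real) set" where
  "polygon es = {v. \<forall>(x, y, d) \<in> set es. \<bar>real_of_int x * snd v - real_of_int y * fst v\<bar> * scale \<le> real_of_int d}"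

definition scale_lo :: "int \<Rightarrow> ival \<Rightarrow> int" where
  "scale_lo c I = (if 0 \<le> c then c * fst I else c * snd I)"

definition scale_hi :: "int \<Rightarrow> ival \<Rightarrow> int" where
  "scale_hi c I = (if 0 \<le> c then c * snd I else c * fst I)"

fun in_strip :: "strip \<Rightarrow> ival \<times> ival \<Rightarrow> bool" where
  "in_strip (x, y, d) (I, J) \<longleftrightarrow>
     scale_hi x J - scale_lo y I \<le> d \<and> scale_hi y I - scale_lo x J \<le> d"

definition in_polygon :: "strip list \<Rightarrow> ival \<times> ival \<Rightarrow> bool" where
  "in_polygon es B \<longleftrightarrow> list_all (\<lambda>e. in_strip e B) es"

lemma scale_bounds:
  assumes "encloses I x"
  shows "of_int (scale_lo c I) \<le> c * x * scale" "c * x * scale \<le> of_int (scale_hi c I)"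
proof -
  have I: "fst I \<le> x * scale" "x * scale \<le> snd I" using assms by (auto simp: encloses_def)
  have "real_of_int c * fst I \<le> c * (x * scale)" "real_of_int c * (x * scale) \<le> c * snd I" if "0 \<le> c"
    using that I by (auto intro: mult_left_mono)
  moreover have "real_of_int c * snd I \<le> c * (x * scale)" "real_of_int c * (x * scale) \<le> c * fst I"
    if "\<not> 0 \<le> c"
    using that I by (auto intro: mult_left_mono_neg)
  ultimately show "of_int (scale_lo c I) \<le> c * x * scale" "c * x * scale \<le> of_int (scale_hi c I)"
    by (auto simp: scale_lo_def scale_hi_def mult.assoc)
qed

lemma in_strip:
  assumes "in_strip (x, y, d) B" "encloses2 B v"
  shows "\<bar>x * snd v - y * fst v\<bar> * scale \<le> d"
proof -
  have v: "encloses (fst B) (fst v)" "encloses (snd B) (snd v)" using assms(2) by (auto simp: encloses2_def)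
  note bounds = scale_bounds[OF v(1), of y] scale_bounds[OF v(2), of x]
  have "scale_hi x (snd B) - scale_lo y (fst B) \<le> d" "scale_hi y (fst B) - scale_lo x (snd B) \<le> d"
    using assms(1) by (cases B; simp)+
  then have "real_of_int (scale_hi x (snd B)) - scale_lo y (fst B) \<le> d"
    "real_of_int (scale_hi y (fst B)) - scale_lo x (snd B) \<le> d"
    by (simp_all flip: of_int_diff)
  then have "(x * snd v - y * fst v) * scale \<le> d" "- (x * snd v - y * fst v) * scale \<le> d"
    using bounds by (simp_all add: left_diff_distrib)
  then show ?thesis by (simp add: abs_if)
qed

lemma in_polygon:
  assumes "in_polygon es B" "encloses2 B v"
  shows "v \<in> polygon es"
proof -
  have "\<bar>real_of_int x * snd v - real_of_int y * fst v\<bar> * scale \<le> real_of_int d"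
    if "(x, y, d) \<in> set es" for x y d
    using that assms(1) in_strip[OF _ assms(2)] unfolding in_polygon_def list_all_iff by blast
  then show ?thesis unfolding polygon_def by blast
qed

lemma convex_polygon: "convex (polygon es)"
proof -
  have "convex {v. \<bar>x * snd v - y * fst v\<bar> * scale \<le> d}" for x y d :: real
  proof -
    have "{v. \<bar>x * snd v - y * fst v\<bar> * scale \<le> d}
        = {v. (-y * scale, x * scale) \<bullet> v \<le> d} \<inter> {v. (y * scale, -x * scale) \<bullet> v \<le> d}"
      by (auto simp: abs_if inner_prod_def algebra_simps)
    then show ?thesis by (simp add: convex_Int convex_halfspace_le)
  qed
  then have "convex (\<Inter>(x, y, d) \<in> set es. {v. \<bar>real_of_int x * snd v - y * fst v\<bar> * scale \<le> d})"
    by (intro convex_INT) auto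
  moreover have "polygon es = (\<Inter>(x, y, d) \<in> set es. {v. \<bar>real_of_int x * snd v - y * fst v\<bar> * scale \<le> d})"
    by (auto simp: polygon_def)
  ultimately show ?thesis by simp
qed

text \<open>A certificate that each point of a triangle returns to a polygon. The state of the check is a
  triangle whose corners are known up to boxes, valid for all parameters in two intervals: \<open>Digit\<close>
  expands the triangle, \<open>Bisect\<close> cuts it at the midpoint of its first edge, \<open>Rotate\<close> makes another
  edge the first one, and \<open>Split1\<close>, \<open>Split2\<close> halve an interval of parameters. Cutting after expanding
  lets neighbouring triangles share their common digits. The flag \<open>moved\<close> makes sure that the digit
  string is not empty.\<close>

datatype return_tree =
    Leaf
  | Digit digit return_tree
  | Rotate return_tree
  | Bisect return_tree return_tree
  | Split1 return_tree return_tree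
  | Split2 return_tree return_tree

fun mid_ival :: "ival \<Rightarrow> ival \<Rightarrow> ival" where
  "mid_ival (l, h) (l', h') = (half (l + l'), half (h + h') + 1)"

fun mid_box :: "ival \<times> ival \<Rightarrow> ival \<times> ival \<Rightarrow> ival \<times> ival" where
  "mid_box (I, J) (I', J') = (mid_ival I I', mid_ival J J')"

primrec returns ::
  "return_tree \<Rightarrow> ival \<Rightarrow> ival \<Rightarrow> strip list \<Rightarrow> bool \<Rightarrow>
    ival \<times> ival \<Rightarrow> ival \<times> ival \<Rightarrow> ival \<times> ival \<Rightarrow> bool" where
  "returns Leaf B1 B2 es moved a b c \<longleftrightarrow>
     moved \<and> in_polygon es a \<and> in_polygon es b \<and> in_polygon es c"
| "returns (Digit d t) B1 B2 es moved a b c \<longleftrightarrow>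
     returns t B1 B2 es True (expand_box B1 B2 d a) (expand_box B1 B2 d b) (expand_box B1 B2 d c)"
| "returns (Rotate t) B1 B2 es moved a b c \<longleftrightarrow> returns t B1 B2 es moved b c a"
| "returns (Bisect t u) B1 B2 es moved a b c \<longleftrightarrow>
     (let m = mid_box a b in returns t B1 B2 es moved c a m \<and> returns u B1 B2 es moved b c m)"
| "returns (Split1 t u) B1 B2 es moved a b c \<longleftrightarrow>
     (let m = half (fst B1 + snd B1) in
      returns t (fst B1, m) B2 es moved a b c \<and> returns u (m, snd B1) B2 es moved a b c)"
| "returns (Split2 t u) B1 B2 es moved a b c \<longleftrightarrow>
     (let m = half (fst B2 + snd B2) in
      returns t B1 (fst B2, m) es moved a b c \<and> returns u B1 (m, snd B2) es moved a b c)"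

lemma half_bounds: "2 * real_of_int (half x) \<le> x" "x \<le> 2 * real_of_int (half x) + 1"
  unfolding half_def by linarith+

lemma mid_box:
  assumes "encloses2 a u" "encloses2 b v"
  shows "encloses2 (mid_box a b) (midpoint u v)"
proof -
  have "encloses (mid_ival I I') ((x + y) / 2)" if "encloses I x" "encloses I' y" for I I' x y
    using that half_bounds(1)[of "fst I + fst I'"] half_bounds(2)[of "snd I + snd I'"]
    by (cases I; cases I') (auto simp: encloses_def field_simps)
  then show ?thesis using assms
    by (cases a; cases b) (auto simp: encloses2_def midpoint_def)
qed

lemma convex_hull_bisect:
  fixes u v w :: "'a::real_vector"
  shows "convex hull {u, v, w} \<subseteq> convex hull {w, u, (1/2) *\<^sub>R (u + v)} \<union> convex hull {v, w, (1/2) *\<^sub>R (u + v)}"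
proof
  fix p assume "p \<in> convex hull {u, v, w}"
  then obtain a b c where abc: "0 \<le> a" "0 \<le> b" "0 \<le> c" "a + b + c = 1"
    and p: "p = a *\<^sub>R u + b *\<^sub>R v + c *\<^sub>R w"
    unfolding convex_hull_3 by blast
  show "p \<in> convex hull {w, u, (1/2) *\<^sub>R (u + v)} \<union> convex hull {v, w, (1/2) *\<^sub>R (u + v)}"
  proof (cases "b \<le> a")
    case True
    have "p = c *\<^sub>R w + (a - b) *\<^sub>R u + (2 * b) *\<^sub>R ((1/2) *\<^sub>R (u + v))"
      unfolding p by (simp add: algebra_simps)
    then have "p \<in> convex hull {w, u, (1/2) *\<^sub>R (u + v)}"
      unfolding convex_hull_3 using True abc
      by (intro CollectI exI[of _ c] exI[of _ "a - b"] exI[of _ "2 * b"]) auto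
    then show ?thesis ..
  next
    case False
    have "p = (b - a) *\<^sub>R v + c *\<^sub>R w + (2 * a) *\<^sub>R ((1/2) *\<^sub>R (u + v))"
      unfolding p by (simp add: algebra_simps)
    then have "p \<in> convex hull {v, w, (1/2) *\<^sub>R (u + v)}"
      unfolding convex_hull_3 using False abc
      by (intro CollectI exI[of _ "b - a"] exI[of _ c] exI[of _ "2 * a"]) auto
    then show ?thesis ..
  qed
qed

lemma expand_hull:
  assumes "v \<in> convex hull {x, y, z}"
  shows "expand b1 b2 d v \<in> convex hull {expand b1 b2 d x, expand b1 b2 d y, expand b1 b2 d z}"
proof -
  obtain a b c where abc: "0 \<le> a" "0 \<le> b" "0 \<le> c" "a + b + c = 1"
    and v: "v = a *\<^sub>R x + b *\<^sub>R y + c *\<^sub>R z"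
    using assms unfolding convex_hull_3 by blast
  have c: "c = 1 - a - b" using abc by simp
  have "expand b1 b2 d v = a *\<^sub>R expand b1 b2 d x + b *\<^sub>R expand b1 b2 d y + c *\<^sub>R expand b1 b2 d z"
    unfolding v c by (simp add: expand_def algebra_simps)
  then show ?thesis unfolding convex_hull_3 using abc by blast
qed

lemma encloses_split: "encloses (l, h) x \<Longrightarrow> encloses (l, m) x \<or> encloses (m, h) x"
  unfolding encloses_def by (simp, linarith)

text \<open>Only the corners are tracked: the polygon is convex and the expansion is affine.\<close>

lemma returns_sound:
  assumes "returns t B1 B2 es moved a b c" "0 \<le> b1" "0 \<le> b2" "encloses B1 b1" "encloses B2 b2"
    and "encloses2 a x" "encloses2 b y" "encloses2 c z" "v \<in> convex hull {x, y, z}"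
  shows "\<exists>w. (moved \<or> w \<noteq> []) \<and> run b1 b2 w v \<in> polygon es"
  using assms(1,4-)
proof (induction t arbitrary: B1 B2 moved a b c x y z v)
  case Leaf
  then have chk: "moved" "in_polygon es a" "in_polygon es b" "in_polygon es c" by simp_all
  have "x \<in> polygon es" by (rule in_polygon[OF chk(2) Leaf.prems(4)])
  moreover have "y \<in> polygon es" by (rule in_polygon[OF chk(3) Leaf.prems(5)])
  moreover have "z \<in> polygon es" by (rule in_polygon[OF chk(4) Leaf.prems(6)])
  ultimately have "convex hull {x, y, z} \<subseteq> polygon es"
    by (intro hull_minimal convex_polygon) simp
  then have "v \<in> polygon es" using Leaf.prems(7) by blast
  then show ?case using chk(1) by (intro exI[of _ "[]"]) simp
next
  case (Digit d t)
  note step = expand_box[OF assms(2,3) Digit.prems(2,3), of _ _ d]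
  obtain w where "run b1 b2 w (expand b1 b2 d v) \<in> polygon es"
    using Digit.IH[OF _ Digit.prems(2,3) step[OF Digit.prems(4)] step[OF Digit.prems(5)]
        step[OF Digit.prems(6)] expand_hull[OF Digit.prems(7)], of True] Digit.prems(1) by auto
  then have "run b1 b2 (d # w) v \<in> polygon es" by simp
  then show ?case by blast
next
  case (Rotate t)
  have "{x, y, z} = {y, z, x}" by blast
  then have "v \<in> convex hull {y, z, x}" using Rotate.prems(7) by simp
  moreover have "returns t B1 B2 es moved b c a" using Rotate.prems(1) by simp
  ultimately show ?case by (intro Rotate.IH[OF _ Rotate.prems(2,3,5,6,4)])
next
  case (Bisect t u)
  let ?m = "(1/2) *\<^sub>R (x + y)"
  have m: "encloses2 (mid_box a b) ?m"
    using mid_box[OF Bisect.prems(4,5)] by (simp add: midpoint_def)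
  have ret: "returns t B1 B2 es moved c a (mid_box a b)" "returns u B1 B2 es moved b c (mid_box a b)"
    using Bisect.prems(1) by (simp_all add: Let_def)
  consider "v \<in> convex hull {z, x, ?m}" | "v \<in> convex hull {y, z, ?m}"
    using convex_hull_bisect Bisect.prems(7) by blast
  then show ?case
  proof cases
    case 1
    then show ?thesis by (rule Bisect.IH(1)[OF ret(1) Bisect.prems(2,3,6,4) m])
  next
    case 2
    then show ?thesis by (rule Bisect.IH(2)[OF ret(2) Bisect.prems(2,3,5,6) m])
  qed
next
  case (Split1 t u)
  let ?m = "half (fst B1 + snd B1)"
  have ret: "returns t (fst B1, ?m) B2 es moved a b c" "returns u (?m, snd B1) B2 es moved a b c"
    using Split1.prems(1) by (simp_all add: Let_def)
  consider "encloses (fst B1, ?m) b1" | "encloses (?m, snd B1) b1"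
    using encloses_split[of "fst B1" "snd B1"] Split1.prems(2) by fastforce
  then show ?case
  proof cases
    case 1 then show ?thesis by (rule Split1.IH(1)[OF ret(1) _ Split1.prems(3-7)])
  next
    case 2 then show ?thesis by (rule Split1.IH(2)[OF ret(2) _ Split1.prems(3-7)])
  qed
next
  case (Split2 t u)
  let ?m = "half (fst B2 + snd B2)"
  have ret: "returns t B1 (fst B2, ?m) es moved a b c" "returns u B1 (?m, snd B2) es moved a b c"
    using Split2.prems(1) by (simp_all add: Let_def)
  consider "encloses (fst B2, ?m) b2" | "encloses (?m, snd B2) b2"
    using encloses_split[of "fst B2" "snd B2"] Split2.prems(3) by fastforce
  then show ?case
  proof cases
    case 1 then show ?thesis by (rule Split2.IH(1)[OF ret(1) Split2.prems(2) _ Split2.prems(4-7)])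
  next
    case 2 then show ?thesis by (rule Split2.IH(2)[OF ret(2) Split2.prems(2) _ Split2.prems(4-7)])
  qed
qed

definition cross :: "int \<times> int \<Rightarrow> int \<times> int \<Rightarrow> int" where
  "cross p q = fst p * snd q - snd p * fst q"

text \<open>Corners of polygons are given on the grid of step \<open>1/128\<close>. The factor \<open>33554432 = 2\<^sup>2\<^sup>5\<close> converts grid
  units to units of \<open>2\<^sup>-\<^sup>3\<^sup>2\<close>.\<close>

definition edge_strip :: "int \<times> int \<Rightarrow> int \<times> int \<Rightarrow> strip" where
  "edge_strip p q = (fst q - fst p, snd q - snd p, 33554432 * cross p q)"

fun edge_strips :: "(int \<times> int) list \<Rightarrow> strip list" where
  "edge_strips (p # q # ps) = edge_strip p q # edge_strips (q # ps)"
| "edge_strips _ = []"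

definition vertex_box :: "int \<times> int \<Rightarrow> ival \<times> ival" where
  "vertex_box p = ((33554432 * fst p, 33554432 * fst p), (33554432 * snd p, 33554432 * snd p))"

fun fan_returns :: "ival \<Rightarrow> ival \<Rightarrow> strip list \<Rightarrow> (int \<times> int) list \<Rightarrow> return_tree list \<Rightarrow> bool" where
  "fan_returns B1 B2 es (p # q # ps) (t # ts) \<longleftrightarrow>
     0 < cross p q \<and> returns t B1 B2 es False (vertex_box (0, 0)) (vertex_box p) (vertex_box q) \<and>
     fan_returns B1 B2 es (q # ps) ts"
| "fan_returns B1 B2 es [p] [] \<longleftrightarrow> True"
| "fan_returns B1 B2 es _ _ \<longleftrightarrow> False"

text \<open>If \<open>ps\<close> is half of the corners, in order, then consecutive elements of this list bound one edge from
  each pair of opposite edges.\<close>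

definition symmetric_closure :: "(int \<times> int) list \<Rightarrow> (int \<times> int) list" where
  "symmetric_closure ps = ps @ [(- fst (hd ps), - snd (hd ps))]"

definition recurrent :: "ival \<Rightarrow> ival \<Rightarrow> (int \<times> int) list \<Rightarrow> return_tree list \<Rightarrow> bool" where
  "recurrent B1 B2 ps ts \<longleftrightarrow>
     fan_returns B1 B2 (edge_strips (symmetric_closure ps)) (symmetric_closure ps) ts"

definition grid_point :: "int \<times> int \<Rightarrow> real \<times> real" where
  "grid_point p = (real_of_int (fst p) / 128, real_of_int (snd p) / 128)"

lemma vertex_box: "encloses2 (vertex_box p) (grid_point p)"
  by (simp add: vertex_box_def grid_point_def encloses2_def encloses_def)

definition rcross :: "real \<times> real \<Rightarrow> real \<times> real \<Rightarrow> real" where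
  "rcross p q = fst p * snd q - snd p * fst q"

text \<open>In the cone spanned by two consecutive corners, the strip of their common edge cuts out a triangle.\<close>

lemma triangle_in_cone:
  assumes "0 < rcross p q" "0 \<le> rcross p v" "rcross q v \<le> 0"
    and edge: "(fst q - fst p) * snd v - (snd q - snd p) * fst v \<ge> - rcross p q"
  shows "v \<in> convex hull {0, p, q}"
proof -
  define a where "a = - rcross q v / rcross p q"
  define b where "b = rcross p v / rcross p q"
  have ab: "0 \<le> a" "0 \<le> b" using assms(1-3) by (auto simp: a_def b_def divide_le_0_iff)
  have "a + b = (rcross p v - rcross q v) / rcross p q" by (simp add: a_def b_def diff_divide_distrib)
  moreover have "rcross p v - rcross q v \<le> rcross p q"
    using edge by (simp add: rcross_def algebra_simps)
  ultimately have "a + b \<le> 1" using assms(1) by simp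
  moreover have "v = a *\<^sub>R p + b *\<^sub>R q"
  proof -
    have "rcross p q * fst v = - rcross q v * fst p + rcross p v * fst q"
      "rcross p q * snd v = - rcross q v * snd p + rcross p v * snd q"
      by (simp_all add: rcross_def algebra_simps)
    then have "fst v = a * fst p + b * fst q" "snd v = a * snd p + b * snd q"
      using assms(1) by (simp_all add: a_def b_def field_simps)
    then show ?thesis by (simp add: prod_eq_iff)
  qed
  ultimately show ?thesis unfolding convex_hull_3
    using ab by (intro CollectI exI[of _ "1 - a - b"] exI[of _ a] exI[of _ b]) simp
qed

lemma rcross_grid: "rcross (grid_point p) (grid_point q) = cross p q / 16384"
  by (simp add: rcross_def cross_def grid_point_def field_simps)

lemma edge_strip_bound:
  assumes "v \<in> polygon [edge_strip p q]"
  shows "\<bar>(fst (grid_point q) - fst (grid_point p)) * snd v - (snd (grid_point q) - snd (grid_point p)) * fst v\<bar>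
    \<le> rcross (grid_point p) (grid_point q)"
proof -
  let ?e = "real_of_int (fst q - fst p) * snd v - real_of_int (snd q - snd p) * fst v"
  have "\<bar>?e\<bar> * scale \<le> 33554432 * real_of_int (cross p q)"
    using assms by (simp add: polygon_def edge_strip_def)
  then have "\<bar>?e\<bar> / 128 \<le> rcross (grid_point p) (grid_point q)" by (simp add: rcross_grid)
  moreover have "(fst (grid_point q) - fst (grid_point p)) * snd v
      - (snd (grid_point q) - snd (grid_point p)) * fst v = ?e / 128"
    by (simp add: grid_point_def field_simps)
  ultimately show ?thesis by simp
qed

text \<open>A vector to the left of the first corner and to the right of the last one lies in the cone of some
  two consecutive corners. The bound on the norm gives boundedness of the polygon.\<close>

lemma fan_returns_sound:
  assumes "fan_returns B1 B2 es ps ts" "0 \<le> b1" "0 \<le> b2" "encloses B1 b1" "encloses B2 b2"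
    and "v \<in> polygon (edge_strips ps)"
    and "0 \<le> rcross (grid_point (hd ps)) v" "rcross (grid_point (last ps)) v \<le> 0" "2 \<le> length ps"
  shows "norm v \<le> (\<Sum>p\<leftarrow>ps. norm (grid_point p)) \<and> (\<exists>w. w \<noteq> [] \<and> run b1 b2 w v \<in> polygon es)"
  using assms(1,6-)
proof (induction ps arbitrary: ts rule: edge_strips.induct)
  case (1 p q ps)
  obtain t ts' where ts: "ts = t # ts'" using 1(2) by (cases ts) auto
  have chk: "0 < cross p q" "returns t B1 B2 es False (vertex_box (0, 0)) (vertex_box p) (vertex_box q)"
    "fan_returns B1 B2 es (q # ps) ts'" using 1(2) unfolding ts by simp_all
  have poly: "v \<in> polygon [edge_strip p q]" "v \<in> polygon (edge_strips (q # ps))"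
    using 1(3) by (auto simp: polygon_def)
  show ?case
  proof (cases "rcross (grid_point q) v \<le> 0")
    case True
    have hull: "v \<in> convex hull {0, grid_point p, grid_point q}"
    proof (rule triangle_in_cone)
      show "0 < rcross (grid_point p) (grid_point q)" using chk(1) by (simp add: rcross_grid)
    qed (use True 1(4) edge_strip_bound[OF poly(1)] in auto)
    have "0 = grid_point (0, 0)" by (simp add: grid_point_def prod_eq_iff)
    then have "\<exists>w. (False \<or> w \<noteq> []) \<and> run b1 b2 w v \<in> polygon es"
      using returns_sound[OF chk(2) assms(2-5) vertex_box vertex_box vertex_box] hull by simp
    moreover have "norm v \<le> norm (grid_point p) + norm (grid_point q)"
    proof -
      have "convex hull {0, grid_point p, grid_point q} \<subseteq> cball 0 (norm (grid_point p) + norm (grid_point q))"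
        by (rule hull_minimal) auto
      then show ?thesis using hull by auto
    qed
    moreover have "0 \<le> (\<Sum>p\<leftarrow>ps. norm (grid_point p))" by (rule sum_list_nonneg) auto
    ultimately show ?thesis by auto
  next
    case False
    then have "ps \<noteq> []" using 1(5) by auto
    then have "norm v \<le> (\<Sum>p\<leftarrow>q # ps. norm (grid_point p)) \<and> (\<exists>w. w \<noteq> [] \<and> run b1 b2 w v \<in> polygon es)"
      using 1(5) False by (intro 1(1)[OF chk(3) poly(2)]) (auto simp: Suc_le_eq)
    then show ?thesis using norm_ge_zero[of "grid_point p"] by (auto intro: add_increasing)
  qed
qed auto

text \<open>The symmetry \<open>v \<mapsto> -v\<close> exchanges the digits \<open>-1\<close> and \<open>1\<close>, so half of the polygon suffices.\<close>

primrec opposite :: "digit \<Rightarrow> digit" where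
  "opposite Minus = Plus"
| "opposite Zero = Zero"
| "opposite Plus = Minus"

lemma expand_uminus: "expand b1 b2 (opposite d) (- v) = - expand b1 b2 d v"
  by (cases d) (simp_all add: expand_def)

lemma run_uminus: "run b1 b2 (map opposite w) (- v) = - run b1 b2 w v"
  by (induction w arbitrary: v) (simp_all add: expand_uminus)

lemma polygon_uminus: "- v \<in> polygon es \<longleftrightarrow> v \<in> polygon es"
proof -
  have "\<bar>x * snd (- v) - y * fst (- v)\<bar> = \<bar>x * snd v - y * fst v\<bar>" for x y :: real
    by (simp add: abs_if)
  then show ?thesis unfolding polygon_def by simp
qed

lemma (in attractor_pair) recurrent_polygon_subset:
  assumes "recurrent B1 B2 ps ts" "ps \<noteq> []" "encloses B1 b1" "encloses B2 b2"
  shows "polygon (edge_strips (symmetric_closure ps)) \<subseteq> D"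
proof -
  let ?qs = "symmetric_closure ps" and ?K = "polygon (edge_strips (symmetric_closure ps))"
  have len: "2 \<le> length ?qs" using assms(2) by (cases ps) (auto simp: symmetric_closure_def)
  have hd: "hd ?qs = hd ps" using assms(2) by (simp add: symmetric_closure_def)
  have last: "rcross (grid_point (last ?qs)) v = - rcross (grid_point (hd ps)) v" for v
    by (simp add: symmetric_closure_def rcross_def grid_point_def)
  have pos: "norm v \<le> (\<Sum>p\<leftarrow>?qs. norm (grid_point p)) \<and> (\<exists>w. w \<noteq> [] \<and> run b1 b2 w v \<in> ?K)"
    if "v \<in> ?K" "0 \<le> rcross (grid_point (hd ps)) v" for v
    using assms(1,3,4) b1 b2 that len unfolding recurrent_def
    by (intro fan_returns_sound) (simp_all add: hd last)
  have all: "norm v \<le> (\<Sum>p\<leftarrow>?qs. norm (grid_point p)) \<and> (\<exists>w. w \<noteq> [] \<and> run b1 b2 w v \<in> ?K)"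
    if v: "v \<in> ?K" for v
  proof (cases "0 \<le> rcross (grid_point (hd ps)) v")
    case True then show ?thesis using pos v by blast
  next
    case False
    have "0 \<le> rcross (grid_point (hd ps)) (- v)" using False by (simp add: rcross_def)
    then have *: "norm (- v) \<le> (\<Sum>p\<leftarrow>?qs. norm (grid_point p))"
      "\<exists>w. w \<noteq> [] \<and> run b1 b2 w (- v) \<in> ?K" using pos[of "- v"] v polygon_uminus by blast+
    then obtain w where "w \<noteq> []" "run b1 b2 w (- v) \<in> ?K" by blast
    then have "map opposite w \<noteq> []" "run b1 b2 (map opposite w) v \<in> ?K"
      using run_uminus[of b1 b2 w "- v"] polygon_uminus by auto
    then show ?thesis using *(1) by auto
  qed
  show ?thesis
  proof (rule recurrent_subset_D)
    show "bounded ?K" using all by (intro boundedI) blast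
  qed (use all in blast)
qed

section \<open>Parameters inside and outside the locus\<close>

text \<open>A subdivision of a box of parameters into boxes that share a digit string leading from \<open>(1, 1)\<close>
  into the polygon.\<close>

datatype address_tree =
    Address "digit list"
  | Halve1 address_tree address_tree
  | Halve2 address_tree address_tree

definition one_box :: "ival \<times> ival" where
  "one_box = ((4294967296, 4294967296), (4294967296, 4294967296))"

primrec addresses :: "address_tree \<Rightarrow> ival \<Rightarrow> ival \<Rightarrow> strip list \<Rightarrow> bool" where
  "addresses (Address w) B1 B2 es \<longleftrightarrow> in_polygon es (run_box B1 B2 w one_box)"
| "addresses (Halve1 t u) B1 B2 es \<longleftrightarrow>
     (let m = half (fst B1 + snd B1) in addresses t (fst B1, m) B2 es \<and> addresses u (m, snd B1) B2 es)"
| "addresses (Halve2 t u) B1 B2 es \<longleftrightarrow>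
     (let m = half (fst B2 + snd B2) in addresses t B1 (fst B2, m) es \<and> addresses u B1 (m, snd B2) es)"

lemma addresses_sound:
  assumes "addresses t B1 B2 es" "0 \<le> b1" "0 \<le> b2" "encloses B1 b1" "encloses B2 b2"
  shows "\<exists>w. run b1 b2 w (1, 1) \<in> polygon es"
  using assms(1,4,5)
proof (induction t arbitrary: B1 B2)
  case (Address w)
  have "encloses2 one_box (1, 1)" by (simp add: one_box_def encloses2_def encloses_def)
  then show ?case
    using run_box[OF assms(2,3) Address(2,3)] in_polygon Address(1) by (metis addresses.simps(1))
next
  case (Halve1 t u)
  let ?m = "half (fst B1 + snd B1)"
  have "addresses t (fst B1, ?m) B2 es" "addresses u (?m, snd B1) B2 es"
    using Halve1.prems(1) by (simp_all add: Let_def)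
  moreover have "encloses (fst B1, ?m) b1 \<or> encloses (?m, snd B1) b1"
    using encloses_split[of "fst B1" "snd B1"] Halve1.prems(2) by simp
  ultimately show ?case using Halve1.IH Halve1.prems(3) by blast
next
  case (Halve2 t u)
  let ?m = "half (fst B2 + snd B2)"
  have "addresses t B1 (fst B2, ?m) es" "addresses u B1 (?m, snd B2) es"
    using Halve2.prems(1) by (simp_all add: Let_def)
  moreover have "encloses (fst B2, ?m) b2 \<or> encloses (?m, snd B2) b2"
    using encloses_split[of "fst B2" "snd B2"] Halve2.prems(3) by simp
  ultimately show ?case using Halve2.IH Halve2.prems(2) by blast
qed

lemma connectedness_locusI:
  assumes "recurrent B1 B2 ps ts" "ps \<noteq> []" "encloses B1 b1" "encloses B2 b2"
    and "addresses t C1 C2 (edge_strips (symmetric_closure ps))" "encloses C1 b1" "encloses C2 b2"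
    and "1 < b1" "1 < b2"
  shows "(b1, b2) \<in> connectedness_locus"
proof -
  interpret attractor_pair b1 b2 "attractor b1 b2" using assms(8,9) by (rule attractor_pair_attractor)
  obtain w where "run b1 b2 w (1, 1) \<in> polygon (edge_strips (symmetric_closure ps))"
    using addresses_sound[OF assms(5) _ _ assms(6,7)] assms(8,9) by auto
  then have "(1, 1) \<in> D"
    using recurrent_polygon_subset[OF assms(1-4)] run_pull by blast
  then show ?thesis using connected_iff assms(8,9) by (simp add: connectedness_locus_def)
qed

definition escaped :: "int \<Rightarrow> int \<Rightarrow> ival \<times> ival \<Rightarrow> bool" where
  "escaped r s B \<longleftrightarrow> r < fst (fst B) \<or> snd (fst B) < - r \<or> s < fst (snd B) \<or> snd (snd B) < - s"

text \<open>Every digit string of length \<open>n\<close> leads out of the box with half sides \<open>r\<close> and \<open>s\<close> at some point. If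
  that box contains \<open>D\<close>, the starting vector is not in \<open>D\<close>, where some orbit never leaves.\<close>

fun dies :: "nat \<Rightarrow> ival \<Rightarrow> ival \<Rightarrow> int \<Rightarrow> int \<Rightarrow> ival \<times> ival \<Rightarrow> bool" where
  "dies 0 B1 B2 r s B \<longleftrightarrow> escaped r s B"
| "dies (Suc n) B1 B2 r s B \<longleftrightarrow> escaped r s B \<or>
     dies n B1 B2 r s (expand_box B1 B2 Minus B) \<and>
     dies n B1 B2 r s (expand_box B1 B2 Zero B) \<and>
     dies n B1 B2 r s (expand_box B1 B2 Plus B)"

lemma (in attractor_pair) dies_sound:
  assumes "dies n B1 B2 r s B" "encloses B1 b1" "encloses B2 b2" "encloses2 B v"
    and r: "scale \<le> r * (b1 - 1)" "scale \<le> s * (b2 - 1)"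
  shows "v \<notin> D"
proof -
  have out: "u \<notin> D" if esc: "escaped r s C" and C: "encloses2 C u" for C u
  proof
    assume u: "u \<in> D"
    have "scale / (b1 - 1) \<le> r" "scale / (b2 - 1) \<le> s"
      using r b1 b2 by (simp_all add: field_simps)
    moreover have "\<bar>fst u\<bar> * scale \<le> scale / (b1 - 1)" "\<bar>snd u\<bar> * scale \<le> scale / (b2 - 1)"
      using fst_D[OF u] snd_D[OF u] by (simp_all add: field_simps)
    ultimately have *: "\<bar>fst u\<bar> * scale \<le> r" "\<bar>snd u\<bar> * scale \<le> s" by linarith+
    have "\<bar>fst u * scale\<bar> \<le> r" "\<bar>snd u * scale\<bar> \<le> s" using * by (simp_all add: abs_mult)
    then show False using esc C unfolding escaped_def encloses2_def encloses_def
      by (auto simp: abs_le_iff)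
  qed
  show ?thesis using assms(1,4)
  proof (induction n arbitrary: B v)
    case 0 then show ?case using out by simp
  next
    case (Suc n)
    show ?case
    proof
      assume v: "v \<in> D"
      then obtain d where "expand b1 b2 d v \<in> D" using D_expand by blast
      moreover have "\<not> escaped r s B" using out Suc.prems(2) v by blast
      then have "dies n B1 B2 r s (expand_box B1 B2 d B)"
        using Suc.prems(1) by (cases d) auto
      ultimately show False
        using Suc.IH expand_box[OF _ _ assms(2,3) Suc.prems(2)] b1 b2 by fastforce
    qed
  qed
qed

section \<open>The certificates\<close>

text \<open>One-letter names keep the trees below readable.\<close>

abbreviation (input) "N \<equiv> Minus"
abbreviation (input) "Z \<equiv> Zero"
abbreviation (input) "P \<equiv> Plus"
abbreviation (input) "DN \<equiv> Digit Minus"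
abbreviation (input) "DZ \<equiv> Digit Zero"
abbreviation (input) "DP \<equiv> Digit Plus"
abbreviation (input) "L \<equiv> Leaf"
abbreviation (input) "R \<equiv> Rotate"
abbreviation (input) "B \<equiv> Bisect"
abbreviation (input) "S \<equiv> Split1"
abbreviation (input) "U \<equiv> Split2"
abbreviation (input) "A \<equiv> Address"
abbreviation (input) "H \<equiv> Halve1"
abbreviation (input) "V \<equiv> Halve2"

text \<open>Four corners of \<open>K\<close> in units of \<open>1/128\<close>; the other four are their opposites. Its elongated shape follows
  the interior of \<open>D\<close>.\<close>

definition octagon :: "(int \<times> int) list" where
  "octagon = [(105, 112), (137, 164), (114, 172), (89, 173)]"

text \<open>The rectangle of parameters, about \<open>[1.65297, 1.65367] \<times> [1.30011, 1.31755]\<close>. Its corners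
  lie on the grid of step \<open>2\<^sup>-\<^sup>2\<^sup>0 = 1/1048576\<close>.\<close>

definition range1 :: ival where "range1 = (7099445248, 7102439424)"
definition range2 :: ival where "range2 = (5583945728, 5658808320)"

text \<open>One tree for each pair of opposite edges of the octagon: it subdivides the triangle spanned by one
  of the two edges and the origin.\<close>

definition return_tree0 :: return_tree where "return_tree0 =
    (R (R (B (R (B (B (R (R (B (B (DN (DN L)) (B (B (DN (B (B (B (DN L) (DN (DZ (DZ (DZ L))))) (DN
    L)) (B (DN L) (B (B (DN L) (DN (DZ (DZ (DZ L))))) (DN L))))) (B (B (B (B (U (B (U (DN (DN (DZ
    (DZ (DZ (DZ (DP L))))))) (DN (DN (B (DN (DP L)) (DZ (DZ (DZ (DZ (DP L))))))))) (DN (DN (DN (DP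
    L))))) (B (U (DN (DN (DZ (DZ (DZ (DZ (B (DP (DZ L)) (DP L)))))))) (DN (DN L))) (U (DN (DN (DN
    (DP L)))) (DN (DN (DN (DP L))))))) (U (B (DN (DN (DZ (DZ (DZ (DZ (DP (DZ L)))))))) (U (DN (DN
    (DZ (DZ (DZ (DZ (DP L))))))) (DN (DN (DZ (DZ (B (DZ L) (DZ (DZ (DP (DZ L))))))))))) (DN (DN
    L)))) (B (U (B (DN (DN (DZ (DZ (DZ (DZ (DP L))))))) (U (DN (DN (DZ (DZ (DZ L))))) (DN (DN (DZ
    (DZ (DZ L))))))) (DN (DN (DZ (DZ (DZ L)))))) (U (B (U (DN (DN (DN (DP L)))) (DN (DN (DN (DP
    L))))) (DN (DN (DZ (DZ (DZ (DZ (DP L)))))))) (B (U (DN (DN (B (DZ (DZ (DZ (DZ (DP L))))) (DN (DP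
    L))))) (DN (B (DN L) (DN (DN (DP L)))))) (DN (DN (DZ (DZ (DZ (DZ (DP L))))))))))) (B (DN (DN (DN
    (DP L)))) (B (U (B (DN (DN (DN (DP L)))) (U (DN (DN (DN (DP L)))) (DN (DN (DN (DP L)))))) (DN (B
    (DN (DN (DP L))) (DN L)))) (U (DN (DN (DN (DP L)))) (DN (DN (DN (DP L)))))))) (B (B (B (DN (DN
    L)) (U (DN (DN (DZ (DZ (DZ (DZ (DP L))))))) (DN (DN L)))) (DN (DN L))) (B (DN (DN (DZ (DZ (DZ
    L))))) (B (U (DN (DN (DZ (DZ (DZ (DZ (DP L))))))) (DN (DN L))) (DN (DN (DZ (DZ (DZ L))))))))))
    (DN (DN L)))) (DN (DN L))))) (B (B (R (R (DN (B (DN (DN (DP L))) (B (B (DN (DN (DP L))) (DN L))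
    (DN (DN (DP L)))))))) (B (B (R (R (B (B (B (B (U (DN (DN (DN (DP (DZ (DZ L)))))) (DN (DN (DN
    L)))) (U (DN (DN (DN (DP (DZ (DZ L)))))) (DN (DN (DN L))))) (B (DN (DN (DN (DP (DZ L))))) (U (B
    (U (DN (DN (DN (DP (DZ (DZ L)))))) (DN (DN (DN (DP (DZ (DZ L))))))) (DN (DN (DN (DP (DZ L))))))
    (B (U (DN (DN (DN (DP (DZ (DZ L)))))) (DN (DN (DN L)))) (DN (DN (DN (DP L)))))))) (DN (DN (DN
    L)))) (DN (DN (DN (DP (DZ L)))))))) (DN (DN (B (DN (DZ (DP L))) (B (B (DN L) (DN (DP (DZ L))))
    (DN L)))))) (DN (B (B (DN (DN (DP L))) (B (B (DN (DN (DP L))) (DN L)) (DN (DN (DP L))))) (DN (DN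
    (DP L))))))) (B (DN (DN L)) (R (R (B (DN (DN L)) (B (B (B (B (B (DN (DN L)) (U (DN (B (DN (DZ
    (DZ (DZ (DZ (DP (DZ L))))))) (DN L))) (DN (DN L)))) (DN (DN L))) (B (DN (DN L)) (B (U (DN (DN
    (DZ (DZ (DZ (DZ (DP L))))))) (DN (DN L))) (DN (DN L))))) (B (B (B (DN (DN (DN (DP L)))) (U (B (U
    (DN (DN (DN (DP L)))) (DN (DN (DN (DP L))))) (DN (DN (DN (DP L))))) (DN (B (DN L) (DN (DN (DP
    L))))))) (DN (DN (DN (DP L))))) (B (B (U (DN (DN (DN (DP L)))) (DN (DN (DN (DP L))))) (U (DN (DN
    (DN (DP L)))) (DN (DN L)))) (B (U (B (DN (DN (DN (DP L)))) (U (DN (DN (DN (DP L)))) (DN (DN (DN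
    (DP L)))))) (DN (DN L))) (U (DN (DN (DN (DP L)))) (DN (DN (DN (DP L))))))))) (DN (DN L)))))))))
    (B (DN L) (DN (DN L))))) (B (B (DN L) (B (DZ L) (DN L))) (R (R (B (DN L) (B (DN (DN L)) (DN
    L)))))))))"

definition return_tree1 :: return_tree where "return_tree1 =
    (B (B (DN L) (B (DZ L) (DN L))) (R (R (B (DN L) (B (DN (B (DN L) (B (B (B (DN (DN (DP L))) (B (B
    (DN (DN (DP L))) (B (DN L) (DN (DN (DP L))))) (DN (DN (DP L))))) (DN (B (B (B (DN L) (B (DN (DP
    L)) (DN L))) (DN (DZ (DP L)))) (B (DN L) (B (DN (DP L)) (DN L)))))) (DN L)))) (DN L))))))"

definition return_tree2 :: return_tree where "return_tree2 =
    (R (R (B (R (R (B (DZ (B (B (DN L) (B (DN (DN L)) (DN L))) (DN L))) (B (DN L) (B (B (B (B (B (DZ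
    (B (DN L) (B (B (DN L) (DN (DN (DN (DN (DP L)))))) (DN L)))) (B (B (B (U (DZ (DN L)) (DZ (DN (DN
    (DN (DN L)))))) (DZ (DN (DN (DN (DN (DP L))))))) (B (DZ (DN (DN (DN (DN L))))) (U (DZ (DN L))
    (DZ (DN (DN (DN (DN L)))))))) (DZ (DN L)))) (B (DZ (DN L)) (B (B (DZ (DN L)) (B (U (B (DZ (DN
    L)) (DN (DZ (DZ (DZ (DN L)))))) (DZ (DN L))) (DZ (DN L)))) (DZ (DN L))))) (B (DN (B (DZ (B (DZ
    L) (B (DZ (DZ (DN L))) (DZ L)))) (B (B (DZ (DZ L)) (DZ L)) (DZ (DZ L))))) (B (B (B (DN (DZ (DZ
    (DZ (DN L))))) (B (DN (DZ (DZ L))) (U (DN (DZ (DZ L))) (DN (DZ (DZ (DN (DP (DN (DN L))))))))))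
    (DN (DZ (DZ (DZ (DN L)))))) (DN (DZ (B (DZ (DZ (DN L))) (B (DZ L) (DZ (DZ (DN L)))))))))) (B (DZ
    (DN (B (B (DN L) (B (B (DN L) (DN (DN (DN L)))) (DN L))) (DN L)))) (B (DZ (DN L)) (B (B (DZ (DN
    L)) (B (B (U (DZ (DN L)) (DZ (DN (DN L)))) (DZ (DN (DN (DN (DN L)))))) (DZ (DN L)))) (DZ (DN
    L)))))) (B (B (B (B (DZ (DN L)) (B (B (B (DN (DZ (DZ (DZ (DZ (DN L)))))) (DZ (DN (DN (DN (DZ
    L)))))) (DN (DZ (DZ (DZ L))))) (DZ (DN (DN (DN L)))))) (DZ (DN L))) (B (DZ (DN (DN (DN L)))) (B
    (B (DZ (DN (DN (DN (DZ L))))) (B (DN L) (DZ (DN (DN (DN (DZ L))))))) (DZ (DN (DN (DN L))))))) (B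
    (DN (B (DZ (DZ (DZ (DN L)))) (B (B (DZ (DZ L)) (B (DZ L) (DZ (DZ L)))) (DZ (B (B (DZ L) (DZ (DZ
    (DN L)))) (DZ L)))))) (B (B (B (DZ (DN L)) (B (B (DZ (DN L)) (U (B (DN (DZ (DZ (DZ (DN L)))))
    (DZ (DN L))) (DZ (DN L)))) (DZ (DN L)))) (DZ (DN L))) (B (B (B (B (DN (DZ (DZ (DZ L)))) (U (DN
    (DZ (DZ (DZ L)))) (B (U (B (DZ (DN L)) (U (DZ (DN (DN (DN (DN (DP L)))))) (DZ (DN L)))) (DZ (DN
    L))) (DZ (DN L))))) (DZ (DN (DN (DN L))))) (B (DN (DZ (DZ (DZ L)))) (B (U (DN L) (B (U (DN (DZ
    (DZ (DZ L)))) (B (DZ (DN L)) (DN (DZ (DZ L))))) (U (DN (DZ (B (DZ L) (DZ (DZ L))))) (DZ (DN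
    L))))) (DN (DZ (DZ (DZ L))))))) (B (B (B (U (B (DN (DZ (DZ (DZ (DN (DZ L)))))) (U (B (DZ (DN L))
    (DN (DZ (DZ (DZ (DN (DZ L))))))) (DZ (DN L)))) (DZ (DN L))) (U (DN (DZ (DZ (DZ (DN (DZ L))))))
    (B (U (DZ (DN (DN (DN (DN (DP L)))))) (DZ (DN L))) (DZ (DN L))))) (B (U (DN (DZ (DZ (DZ (DN
    L))))) (DZ (DN L))) (U (B (DZ (DN L)) (DN (DZ (DZ (DZ (DN (DZ L))))))) (DZ (DN L))))) (B (DZ (DN
    L)) (B (U (DN (DZ (DZ (DZ L)))) (B (DZ (DN L)) (U (B (U (DZ (DN (DN (DN (DN (DP L)))))) (DZ (DN
    L))) (DZ (DN L))) (DZ (DN L))))) (U (DN (DZ (DZ (DZ L)))) (DZ (DN L))))))))))))))) (B (DZ L) (B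
    (DN L) (DZ (DN L)))))))"

definition return_tree3 :: return_tree where "return_tree3 =
    (R (B (B (B (B (DZ L) (B (B (B (DP (DN L)) (B (DZ L) (B (B (B (DP (DN L)) (U (B (DZ L) (DP (DN
    L))) (DP (DN (DN (DN L)))))) (DP (DN L))) (B (DP (DN (DN (DN L)))) (B (DZ L) (DP (DN (DN (DN
    L))))))))) (DP (DN L))) (B (B (B (DZ L) (DP (DN L))) (DZ L)) (B (DZ L) (B (DP (DN L)) (DZ
    L)))))) (DZ L)) (B (B (DZ L) (B (DZ (B (DN L) (B (B (DN L) (B (DN (DN L)) (DN L))) (DN L)))) (B
    (B (B (DZ L) (B (B (B (U (DZ (DN (DZ L))) (B (U (DZ (DN (DZ L))) (B (DZ L) (DZ (DN (DZ L)))))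
    (DZ L))) (U (DZ (DN L)) (B (DZ L) (U (DZ (DN (DZ L))) (B (DZ (DN (DZ L))) (DZ L)))))) (B (DZ (DN
    (DZ L))) (U (DZ (DN (DZ L))) (B (U (B (DZ (DN (DZ L))) (DZ L)) (B (DZ (DN (DZ L))) (DZ L))) (DZ
    (DN (DZ L))))))) (DZ L))) (DZ L)) (B (B (B (DZ (DN L)) (DZ L)) (DZ (DN L))) (B (DZ (DN L)) (B
    (DZ L) (DZ (DN L)))))))) (B (B (B (B (B (DZ L) (DZ (DZ (B (B (DZ L) (DZ (DZ (DN L)))) (DZ L)))))
    (DZ L)) (B (DZ L) (B (DZ (B (DZ L) (DZ (B (B (DZ L) (DZ (DZ (DN L)))) (DZ L))))) (DZ L)))) (B
    (DP (DN L)) (B (B (B (B (DZ (DZ (DZ (DZ L)))) (B (DZ L) (U (DZ (DZ (DZ (DZ L)))) (B (U (DZ (DZ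
    (DZ (DZ L)))) (B (U (B (DP (DN L)) (U (DZ (DZ (DZ L))) (B (DZ L) (DP (DN L))))) (B (DP (DN L))
    (U (B (DZ L) (DP (DN L))) (DP (DN L))))) (DP (DN L)))) (DZ L))))) (B (DP (DN L)) (B (U (B (U (DZ
    L) (DP (DN L))) (DZ L)) (DP (DN (DN (DN L))))) (U (B (DZ (DZ (DZ (DZ L)))) (U (B (DP (DN L)) (DZ
    (DZ (DZ (DZ L))))) (DP (DN L)))) (DP (DN L)))))) (DZ L)) (B (B (B (B (U (DZ (DZ (DZ (DZ (DN
    L))))) (B (DP (DN (DN (DN (DN (DP L)))))) (U (DZ (DZ (DZ (DZ (DN (DZ L)))))) (DP (DN (DN (DN (DN
    (DP L))))))))) (U (B (DP (DN L)) (U (B (DZ (DZ (DZ (DZ L)))) (U (DZ (DZ (DZ (DZ L)))) (DP (DN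
    L)))) (B (U (B (DP (DN L)) (DZ (DZ (DZ L)))) (DP (DN L))) (DP (DN L))))) (DP (DN L)))) (DZ (DZ
    (DZ L)))) (B (B (U (B (U (DZ (DZ (DZ (DZ (DN (DZ L)))))) (B (DZ (DZ (DZ L))) (DP (DN L)))) (DZ
    (DZ (DZ L)))) (B (DP (DN L)) (DZ (DZ (DZ (DZ (DN L))))))) (U (B (DZ (DZ (DZ (DZ (DN L))))) (U
    (DZ (DZ (DZ (DZ (DN (DZ L)))))) (B (DP (DN L)) (DZ (DZ (DZ (DZ (DN L)))))))) (DP (DN L)))) (B
    (DP (DN L)) (U (B (DZ (DZ (DZ (DZ (DN L))))) (U (DZ (DZ (DZ (DZ (DN (DZ L)))))) (DP (DN L)))) (B
    (U (DZ (DZ (DZ (DZ (DN (DZ L)))))) (DP (DN (DN (DN (DN (DP L))))))) (DP (DN L))))))) (B (DP (DN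
    L)) (B (B (U (B (U (DZ (DZ (DZ L))) (DZ (DZ (DZ (DZ (DN (DZ (DZ L)))))))) (DZ (DZ (DZ (DZ L)))))
    (B (U (B (U (DZ (DZ (DZ (DZ L)))) (B (DP (DN L)) (DZ (DZ (DZ L))))) (U (DZ (DZ (B (DZ L) (DZ (DZ
    L))))) (DP (DN L)))) (B (U (B (DP (DN L)) (DZ (DZ (DZ L)))) (B (DP (DN L)) (DZ (DZ (DZ L)))))
    (DP (DN L)))) (U (DZ (DZ (DZ (DZ L)))) (B (DP (DN L)) (U (B (U (DZ (DZ (DZ L))) (B (DP (DN L))
    (DZ (DZ (DZ L))))) (DP (DN L))) (B (U (B (DP (DN L)) (DZ (DZ (DZ L)))) (DP (DN L))) (DP (DN
    L)))))))) (DZ (DZ (DZ L)))) (B (U (B (U (DZ (DZ (DZ (DZ L)))) (B (DP (DN L)) (U (DZ (DZ (DZ (DZ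
    L)))) (DP (DN L))))) (DP (DN L))) (DP (DN L))) (U (B (DP (DN L)) (U (DZ (DZ (DZ (DZ L)))) (B (U
    (DZ (DZ (DZ (DZ L)))) (DP (DN L))) (DP (DN L))))) (DP (DN L)))))))))) (DZ L)))) (B (B (DP L) (B
    (B (DP L) (DP (DP L))) (DP L))) (B (B (DP L) (DZ L)) (DP L)))))"

text \<open>Digit strings along the four sides of the rectangle.\<close>

definition left_addresses :: address_tree where "left_addresses =
    (V (V (V (V (A [N,N,N,P,Z,Z,P,P,Z,P,Z,P,Z,P,P,P]) (A [N,N,N,P,Z,Z,P,P,Z,P,Z,P,Z,P,P,P,Z])) (V (V
    (A [N,N,N,P,Z,P,Z,N,P,P,P,P,P,P,P,P,P,P,Z]) (A [N,N,N,P,Z,Z,P,P,Z,P,Z,P,P,N,P,P,P,P,P])) (V (A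
    [N,N,N,P,Z,Z,P,P,Z,P,Z,P,P,N,P,P,P,P,P]) (A [N,N,Z,N,Z,P,P,Z,P,P,P,P,P,Z,P,Z,P,P,P,P])))) (V (V
    (V (V (A [N,N,Z,N,Z,P,P,Z,P,P,P,P,P,Z,P,Z,P,P,P,P]) (A
    [N,N,N,P,Z,P,Z,N,P,P,P,P,P,P,P,P,P,Z,P,P,P,P])) (V (V (A
    [N,N,Z,N,Z,P,P,Z,P,P,P,P,P,Z,P,Z,P,P,P,P,Z,Z,P,P,P,P]) (A
    [N,N,Z,N,Z,P,P,Z,P,P,P,P,P,Z,P,Z,P,P,P,P,Z,Z,P,P])) (A
    [N,N,N,P,Z,Z,P,P,Z,P,Z,P,Z,P,P,Z,P,P,P]))) (V (A [N,N,N,P,Z,Z,P,P,Z,P,Z,P,Z,P,P,Z,P,P,P]) (A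
    [N,N,N,P,Z,Z,P,P,Z,P,Z,P,Z,P,P,Z,P,P,P,P]))) (V (V (V (A
    [N,N,N,P,Z,Z,P,P,Z,P,Z,P,Z,P,P,Z,P,P,P,P,Z]) (V (A
    [N,N,N,Z,P,P,P,P,P,P,Z,Z,N,Z,N,N,N,N,Z,N,N,Z,N,Z,N,Z]) (A
    [N,N,N,P,Z,Z,P,P,Z,P,Z,P,Z,P,P,Z,P,P,P,P,Z,Z,P,P]))) (V (V (A
    [N,N,N,P,Z,Z,P,P,Z,P,Z,P,Z,P,P,Z,P,P,P,P,Z,Z,P,P]) (A
    [N,N,N,P,Z,Z,P,P,Z,P,Z,P,Z,P,P,Z,P,P,P,P,Z,Z,P,P,Z,P])) (A
    [N,N,N,Z,P,P,P,P,P,P,Z,Z,N,Z,N,N,N,N,Z,N,N,Z,N]))) (V (V (A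
    [N,N,N,Z,P,P,P,P,P,P,Z,Z,N,Z,N,N,N,N,Z,N,N]) (A [N,N,N,Z,P,P,P,P,P,P,Z,Z,N,Z,N,N,N,N,Z,N,N])) (V
    (A [N,N,N,Z,P,P,P,P,P,P,Z,Z,N,Z,N,N,N,N,N,P,N,N,N]) (A
    [N,N,N,Z,P,P,P,P,P,P,Z,Z,N,Z,N,N,N,N,N,P,N,N])))))) (V (V (V (V (V (A
    [N,N,N,Z,P,P,P,P,P,P,Z,Z,N,Z,N,N,N,N,Z,N,N]) (A [N,N,N,Z,P,P,P,P,P,P,Z,Z,N,Z,N,N,N,N,Z,N])) (V
    (A [N,N,N,Z,P,P,P,P,P,P,Z,Z,N,Z,N,N,N,N]) (A [N,N,N,Z,P,P,P,P,P,P,Z,Z,N,Z,N,N,N,N]))) (V (A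
    [N,N,N,Z,P,P,P,P,P,P,Z,Z,N,Z,N,N,N,N]) (A [N,N,N,Z,P,P,P,P,P,P,Z,Z,N,Z,N,N,N,N]))) (V (A
    [N,N,N,Z,P,P,P,P,P,P,Z,Z,N,Z,N,N,N,N]) (V (A [N,N,N,Z,P,P,P,P,P,P,Z,Z,N,Z,N,N,N,N]) (A
    [N,N,N,Z,P,P,P,P,P,P,Z,Z,N,Z,N,N,N,N,N,N,P])))) (V (V (V (A
    [N,N,N,Z,P,P,P,P,P,P,Z,Z,N,Z,N,N,N,N,N,N]) (V (A [N,N,N,Z,P,P,P,P,P,P,Z,Z,N,Z,N,N,N,N,N,N]) (A
    [N,N,N,Z,P,P,P,P,P,P,Z,Z,N,Z,N,N,N,N,N,N]))) (V (V (V (A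
    [N,N,N,Z,P,P,P,P,P,P,Z,Z,N,Z,N,N,N,N,N,N]) (A [N,N,N,Z,P,P,P,P,P,P,Z,Z,N,Z,N,N,N,N,N,N,Z,P,P]))
    (A [N,N,N,Z,P,P,P,P,P,P,Z,Z,N,Z,N,N,N,N,N,N,Z,P,P])) (V (V (A
    [N,N,N,Z,P,P,P,P,P,P,Z,Z,N,Z,N,N,N,N,N,N,P,N,P,P,P,Z]) (A
    [N,N,N,Z,P,P,P,P,P,P,Z,Z,N,Z,N,N,N,N,N,N,Z,P,P])) (V (A
    [N,N,N,Z,P,P,P,P,P,P,Z,Z,N,Z,N,N,N,N,N,N,Z,P,P,Z,P]) (V (A
    [N,N,N,Z,P,P,P,P,P,P,Z,Z,N,Z,N,N,N,N,N,N,Z,P,P,Z,P]) (A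
    [N,N,N,Z,P,P,P,P,P,P,Z,Z,N,Z,N,N,N,N,N,N,Z,P,P,Z,P,Z,P,Z])))))) (V (V (V (V (V (V (A
    [N,N,N,Z,P,P,P,P,P,P,Z,Z,N,Z,N,N,N,N,N,N,Z,P,P,Z,P,Z,P,Z]) (A
    [N,N,N,Z,P,P,P,P,P,P,Z,Z,N,Z,N,N,N,N,N,N,Z,P,P,Z,P,Z,P,Z,Z,P])) (V (A
    [N,N,N,Z,P,P,P,P,P,P,Z,Z,N,Z,N,N,N,N,N,N,Z,P,P,P,N,Z,P,P,P,P]) (A
    [N,N,N,Z,P,P,P,P,P,P,Z,Z,N,Z,N,N,N,N,N,N,P,N,P,P,Z,P,P,P,P,P]))) (V (V (A
    [N,N,N,Z,P,P,P,P,P,P,Z,Z,N,Z,N,N,N,N,N,N,P,N,P,P,Z,P,P,P,P]) (A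
    [N,N,N,Z,P,P,P,P,P,P,Z,Z,N,Z,N,N,N,N,N,N,P,N,P,P,Z,P,P,P,P])) (V (A
    [N,N,N,Z,P,P,P,P,P,P,Z,Z,N,Z,N,N,N,N,N,N,P,N,P,P,Z,P,P,P,P]) (V (A
    [N,N,N,Z,P,P,P,P,P,P,Z,Z,N,Z,N,N,N,N,N,N,P,N,P,P,Z,P,P,P,P]) (A
    [N,N,N,Z,P,P,P,P,P,P,Z,Z,N,N,Z,Z,N,N,Z,Z,N,N,N,Z,N,N,Z,N,Z,N]))))) (V (V (V (A
    [N,N,N,Z,P,P,P,P,P,P,Z,Z,N,N,Z,Z,N,N,Z,Z,N,N,N,Z,N,N,Z,N,Z,N]) (A
    [N,N,N,Z,P,P,P,P,P,P,Z,Z,N,N,Z,Z,N,N,Z,Z,N,N,N,Z,N,N,Z,N])) (V (A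
    [N,N,N,Z,P,P,P,P,P,P,Z,Z,N,N,Z,Z,N,N,Z,Z,N,N,N,Z,N,N,Z,N]) (A
    [N,N,N,Z,P,P,P,P,P,P,Z,Z,N,N,Z,Z,N,N,Z,Z,N,N,N,Z,N,N,Z,N]))) (V (V (A
    [N,N,N,Z,P,P,P,P,P,P,Z,Z,N,N,Z,Z,N,N,Z,Z,N,N,N,Z,N,N]) (A
    [N,N,N,Z,P,P,P,P,P,P,Z,Z,N,N,Z,Z,N,N,Z,Z,N,N,N,N,P,N,N,N,Z,N])) (A
    [N,N,N,Z,P,P,P,P,P,P,Z,Z,N,N,Z,Z,N,N,Z,Z,N,N,N,Z,N,N])))) (V (V (A
    [N,N,N,Z,P,P,P,P,P,P,Z,Z,N,N,Z,Z,N,N,Z,Z,N,N,N,Z,N,N]) (V (A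
    [N,N,N,Z,P,P,P,P,P,P,Z,Z,N,N,Z,Z,N,N,Z,Z,N,N,N,Z,N,N]) (V (A
    [N,N,N,Z,P,P,P,P,P,P,Z,Z,N,N,Z,Z,N,N,Z,Z,N,N,N]) (A
    [N,N,N,Z,P,P,P,P,P,P,Z,Z,N,N,Z,Z,N,N,Z,Z,N,N,N])))) (V (V (A
    [N,N,N,Z,P,P,P,P,P,P,Z,Z,N,N,Z,Z,N,N,Z,Z,N,N,N]) (A
    [N,N,N,Z,P,P,P,P,P,P,Z,Z,N,N,Z,Z,N,N,Z,Z,N,N,N])) (A
    [N,N,N,Z,P,P,P,P,P,P,Z,Z,N,N,Z,Z,N,N,Z,Z,N,N,N])))) (V (V (A
    [N,N,N,Z,P,P,P,P,P,P,Z,Z,N,N,Z,Z,N,N,Z,Z,N,N,N]) (V (A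
    [N,N,N,Z,P,P,P,P,P,P,Z,Z,N,N,Z,Z,N,N,Z,Z,N,N,N]) (V (A
    [N,N,N,Z,P,P,P,P,P,P,Z,Z,N,N,Z,Z,N,N,Z,Z,N,N,N]) (A
    [N,N,N,Z,P,P,P,P,P,P,Z,Z,N,N,Z,Z,N,N,Z,Z,N,N,N])))) (V (V (A
    [N,N,N,Z,P,P,P,P,P,P,Z,Z,N,N,Z,Z,N,N,Z,Z,N,N,N,N,N]) (V (A
    [N,N,N,Z,P,P,P,P,P,P,Z,Z,N,N,Z,Z,N,N,Z,Z,N,N,N,N,N]) (A
    [N,N,N,Z,P,P,P,P,P,P,Z,Z,N,N,Z,N,P,N,N,Z,N,N,Z,N,N,N]))) (V (A
    [N,N,N,Z,P,P,P,P,P,P,Z,Z,N,N,Z,N,P,N,N,Z,N,N,Z,N,N,N]) (V (A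
    [N,N,N,Z,P,P,P,P,P,P,Z,Z,N,N,Z,N,P,N,N,Z,N,N,Z,N,N,N]) (V (A
    [N,N,N,Z,P,P,P,P,P,P,Z,Z,N,N,Z,N,P,N,N,Z,N,N,Z,N,N,N]) (A
    [N,N,N,Z,P,P,P,P,P,P,Z,Z,N,N,Z,N,P,N,N,Z,N,N,Z,N,N,N,N]))))))))))"

definition right_addresses :: address_tree where "right_addresses =
    (V (V (V (V (V (V (A [N,N,Z,N,Z,P,P,Z,P,P,P,P,Z,P,P,P]) (A
    [N,N,Z,N,Z,P,P,Z,P,P,P,P,Z,P,P,P,Z,P,P,P])) (A [N,N,Z,N,Z,P,P,Z,P,P,P,P,Z,P,P,P,Z,P,P])) (V (A
    [N,N,Z,N,Z,P,P,Z,P,P,P,P,Z,P,P,P,P,N,P,P,P]) (A [N,N,Z,N,Z,P,P,Z,P,P,P,P,Z,P,P,P,Z,P,P,Z,P])))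
    (V (A [N,N,N,P,Z,P,N,P,P,Z,P,P,P,P,P,P,P,P]) (A [N,N,N,P,Z,P,N,P,P,Z,P,P,P,P,P,P]))) (V (V (A
    [N,N,N,P,Z,P,N,P,P,Z,P,P,P,P,P,P,P,Z]) (A [N,N,N,Z,P,P,P,P,P,P,Z,Z,N,N,Z,N,N,N])) (V (V (A
    [N,N,N,Z,P,P,P,P,P,P,Z,Z,N,N,Z,N,N,N]) (A [N,N,N,Z,P,P,P,P,P,P,Z,Z,N,N,Z,N,N,N,N,N])) (V (A
    [N,N,N,Z,P,P,P,P,P,P,Z,Z,N,N,Z,N,N,N,N,N]) (A [N,N,N,P,Z,P,N,P,P,Z,P,P,P,P,P,P,Z,P,P,P,P])))))
    (V (V (V (V (V (A [N,N,N,P,Z,P,N,P,P,Z,P,P,P,P,P,P,Z,P,P,P,P,Z,P]) (A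
    [N,N,N,Z,P,P,P,P,P,P,Z,N,P,N,N,N,N,N,N,P,Z,N,N])) (A [N,N,N,Z,P,P,P,P,P,P,Z,N,P,N,N,N,N,N,Z,N]))
    (V (A [N,N,N,Z,P,P,P,P,P,P,Z,N,P,N,N,N,N,N]) (A [N,N,N,Z,P,P,P,P,P,P,Z,N,P,N,N,N,N,N]))) (V (A
    [N,N,N,Z,P,P,P,P,P,P,Z,N,P,N,N,N,N,N]) (A [N,N,N,Z,P,P,P,P,P,P,Z,Z,N,N,N,Z,Z,N]))) (V (V (A
    [N,N,N,Z,P,P,P,P,P,P,Z,Z,N,N,N,Z]) (A [N,N,N,Z,P,P,P,P,P,P,Z,Z,N,N,N])) (A
    [N,N,N,Z,P,P,P,P,P,P,Z,Z,N,N,N]))))"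

definition bottom_addresses :: address_tree where "bottom_addresses =
    (H (H (H (A [N,N,N,P,Z,Z,P,P,Z,P,Z,P,Z,P,P]) (H (A [N,N,N,P,Z,Z,P,P,Z,P,Z,P,P,N,P,P,P]) (A
    [N,N,N,P,Z,Z,P,P,Z,P,Z,P,Z,P,P]))) (H (H (A [N,N,N,P,Z,Z,P,P,Z,P,Z,P,Z,P,P,Z,P]) (H (A
    [N,N,N,P,Z,Z,P,P,Z,P,Z,P,Z,P,P,Z,P]) (H (A [N,N,N,P,Z,Z,P,P,Z,P,Z,P,Z,P,P,Z,P]) (H (A
    [N,N,N,P,Z,Z,P,P,Z,P,Z,P,Z,P,P,Z,P,Z,P]) (A [N,N,N,P,Z,Z,P,P,Z,P,Z,P,Z,P,P,Z,P,Z,P,Z]))))) (H (H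
    (H (H (A [N,N,N,P,Z,Z,P,P,Z,P,Z,P,Z,P,P,P,N,Z,P,P,P]) (A
    [N,N,Z,N,Z,P,P,Z,P,P,P,P,P,Z,P,Z,Z,P,P,P])) (A [N,N,Z,N,Z,P,P,Z,P,P,P,P,P,Z,P,Z,Z,P,P,P])) (H (H
    (A [N,N,N,P,Z,Z,P,P,Z,P,Z,P,P,N,P,P,Z,P,P,P,Z,P]) (H (A
    [N,N,N,P,Z,Z,P,P,Z,P,Z,P,P,N,P,P,Z,P,P,P,Z,P,Z]) (A [N,N,N,P,Z,Z,P,P,Z,P,Z,P,Z,P,P,Z,P,Z,Z,P])))
    (H (A [N,N,N,P,Z,Z,P,P,Z,P,Z,P,Z,P,P,Z,P,Z,Z,P,Z,P]) (H (H (A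
    [N,N,Z,N,Z,P,P,Z,P,P,P,P,P,Z,P,Z,Z,P,P,Z,P,P]) (A
    [N,N,Z,N,Z,P,P,Z,P,P,P,P,P,Z,P,Z,Z,P,P,Z,P,P])) (A
    [N,N,Z,N,Z,P,P,Z,P,P,P,P,P,Z,P,Z,Z,P,P,Z,P,P]))))) (H (H (H (A
    [N,N,N,P,Z,P,Z,N,P,P,P,P,P,P,P,P,Z,Z,P,P,P,P]) (A [N,N,N,P,Z,Z,P,P,Z,P,Z,P,Z,P,P,Z,Z,P,P])) (A
    [N,N,N,P,Z,Z,P,P,Z,P,Z,P,Z,P,P,Z,Z,P,P])) (H (A [N,N,N,P,Z,Z,P,P,Z,P,Z,P,Z,P,P,Z,Z,P,P]) (A
    [N,N,N,P,Z,Z,P,P,Z,P,Z,P,Z,P,P,Z,Z,P,P])))))) (H (H (H (H (A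
    [N,N,Z,N,Z,P,P,Z,P,P,P,P,P,Z,Z,P,P,P]) (A [N,N,Z,N,Z,P,P,Z,P,P,P,P,P,Z,Z,P,P,P])) (H (H (A
    [N,N,Z,N,Z,P,P,Z,P,P,P,P,P,Z,Z,P,P,P]) (A [N,N,Z,N,Z,P,P,Z,P,P,P,P,P,Z,Z,P,P,P,Z,P])) (H (A
    [N,N,N,P,Z,Z,P,P,Z,P,Z,P,Z,P,Z,P,P,P]) (A [N,N,N,P,Z,Z,P,P,Z,P,Z,P,Z,P,Z,P,P,P])))) (H (H (A
    [N,N,N,P,Z,Z,P,P,Z,P,Z,P,Z,P,Z,P,P,P]) (A [N,N,N,P,Z,Z,P,P,Z,P,Z,P,Z,P,Z,P,P,P])) (H (H (A
    [N,N,N,P,Z,Z,P,P,Z,P,Z,P,Z,P,Z,P,P,P]) (H (A [N,N,N,P,Z,Z,P,P,Z,P,Z,P,Z,P,Z,P,P,P,Z]) (A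
    [N,N,N,P,Z,Z,P,P,Z,P,Z,P,Z,P,P,N,P,P,P,P]))) (H (A [N,N,N,P,Z,Z,P,P,Z,P,Z,P,Z,P,P,N,P,P,P,P]) (H
    (A [N,N,N,P,Z,Z,P,P,Z,P,Z,P,Z,P,P,N,P,P,P,P]) (A
    [N,N,N,P,Z,Z,P,P,Z,P,Z,P,Z,P,P,N,P,P,P,P,Z,P])))))) (H (H (H (H (A
    [N,N,N,P,Z,Z,P,P,Z,P,Z,P,Z,P,Z,P,P,Z,P,P]) (H (A [N,N,Z,N,Z,P,P,Z,P,P,P,P,Z,P,P,P]) (A
    [N,N,Z,N,Z,P,P,Z,P,P,P,P,Z,P,P,P]))) (A [N,N,Z,N,Z,P,P,Z,P,P,P,P,Z,P,P,P])) (A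
    [N,N,Z,N,Z,P,P,Z,P,P,P,P,Z,P,P,P])) (A [N,N,Z,N,Z,P,P,Z,P,P,P,P,Z,P,P,P]))))"

definition top_addresses :: address_tree where "top_addresses =
    (H (H (H (H (H (H (H (H (H (H (H (A [N,N,N,Z,P,P,P,P,P,P,Z,Z,N,N,Z,Z,N,N,Z,N,Z,Z,N,Z,N,Z,N]) (A
    [N,N,N,Z,P,P,P,P,P,P,Z,Z,N,N,Z,Z,N,N,Z,N,Z,Z,N,Z,N])) (A
    [N,N,N,Z,P,P,P,P,P,P,Z,Z,N,N,Z,Z,N,N,Z,N,Z,Z,N,Z,N])) (H (A
    [N,N,N,Z,P,P,P,P,P,P,Z,Z,N,N,Z,Z,N,N,Z,N,Z,Z,N,Z,N]) (A
    [N,N,N,Z,P,P,P,P,P,P,Z,Z,N,N,Z,Z,N,N,Z,N,Z,Z,N]))) (H (A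
    [N,N,N,Z,P,P,P,P,P,P,Z,Z,N,N,Z,Z,N,N,Z,N,Z,Z,N]) (A
    [N,N,N,Z,P,P,P,P,P,P,Z,Z,N,N,Z,Z,N,N,Z,N,Z,Z,N]))) (H (A
    [N,N,N,Z,P,P,P,P,P,P,Z,Z,N,N,Z,N,P,N,N,Z,N,N,N]) (A
    [N,N,N,Z,P,P,P,P,P,P,Z,Z,N,N,Z,Z,N,N,Z,N,Z]))) (H (A
    [N,N,N,Z,P,P,P,P,P,P,Z,Z,N,N,Z,Z,N,N,Z,N,Z]) (A [N,N,N,Z,P,P,P,P,P,P,Z,Z,N,N,Z,Z,N,N,Z,N]))) (H
    (A [N,N,N,Z,P,P,P,P,P,P,Z,Z,N,N,Z,Z,N,N,Z,N]) (A [N,N,N,Z,P,P,P,P,P,P,Z,Z,N,N,Z,Z,N,N]))) (H (A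
    [N,N,N,Z,P,P,P,P,P,P,Z,Z,N,N,Z,Z,N,N]) (A [N,N,N,Z,P,P,P,P,P,P,Z,Z,N,N,Z,Z,N,N]))) (H (H (H (A
    [N,N,N,Z,P,P,P,P,P,P,Z,Z,N,N,Z,Z,N,N]) (H (A [N,N,N,Z,P,P,P,P,P,P,Z,Z,N,N,Z,Z,N,N]) (A
    [N,N,N,Z,P,P,P,P,P,P,Z,Z,N,N,Z,Z,N,N]))) (H (H (H (A [N,N,N,Z,P,P,P,P,P,P,Z,Z,N,N,Z,Z,N,N]) (A
    [N,N,N,Z,P,P,P,P,P,P,Z,Z,N,N,Z,Z,N,N,N,N,N,P])) (H (A
    [N,N,N,Z,P,P,P,P,P,P,Z,N,P,N,N,Z,N,N,Z,N,N]) (A [N,N,N,Z,P,P,P,P,P,P,Z,N,P,N,N,Z,N,N,Z,N,N])))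
    (H (A [N,N,N,Z,P,P,P,P,P,P,Z,N,P,N,N,Z,N,N,Z,N,N]) (H (A
    [N,N,N,Z,P,P,P,P,P,P,Z,N,P,N,N,Z,N,N,Z,N,N]) (A [N,N,N,Z,P,P,P,P,P,P,Z,N,P,N,N,Z,N,N,Z,N,N])))))
    (H (H (H (H (A [N,N,N,Z,P,P,P,P,P,P,Z,Z,N,N,Z,N,Z,Z,N,Z,N]) (A
    [N,N,N,Z,P,P,P,P,P,P,Z,Z,N,N,Z,N,Z,Z,N,Z,N])) (A [N,N,N,Z,P,P,P,P,P,P,Z,Z,N,N,Z,N,Z,Z,N,Z,N]))
    (H (A [N,N,N,Z,P,P,P,P,P,P,Z,Z,N,N,Z,N,Z,Z,N]) (A [N,N,N,Z,P,P,P,P,P,P,Z,Z,N,N,Z,N,Z,Z,N]))) (H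
    (A [N,N,N,Z,P,P,P,P,P,P,Z,Z,N,N,Z,N,Z,Z,N]) (A [N,N,N,Z,P,P,P,P,P,P,Z,N,P,N,N,Z,N,N,N]))))) (H
    (H (H (A [N,N,N,Z,P,P,P,P,P,P,Z,N,P,N,N,Z,N,N,N]) (A [N,N,N,Z,P,P,P,P,P,P,Z,Z,N,N,Z,N,Z])) (H (A
    [N,N,N,Z,P,P,P,P,P,P,Z,Z,N,N,Z,N]) (A [N,N,N,Z,P,P,P,P,P,P,Z,Z,N,N,Z,N]))) (A
    [N,N,N,Z,P,P,P,P,P,P,Z,Z,N,N,Z,N]))) (H (H (A [N,N,N,Z,P,P,P,P,P,P,Z,Z,N,N]) (A
    [N,N,N,Z,P,P,P,P,P,P,Z,N,P,N,N,N])) (A [N,N,N,Z,P,P,P,P,P,P,Z,Z,N,N])))"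

lemma octagon_recurrent:
  "recurrent range1 range2 octagon [return_tree0, return_tree1, return_tree2, return_tree3]"
  by code_simp

lemma left_side:
  "addresses left_addresses (7099445248, 7099445248) (5583945728, 5658808320)
    (edge_strips (symmetric_closure octagon))"
  by code_simp

lemma right_side:
  "addresses right_addresses (7102439424, 7102439424) (5583945728, 5658808320)
    (edge_strips (symmetric_closure octagon))"
  by code_simp

lemma bottom_side:
  "addresses bottom_addresses (7099445248, 7102439424) (5583945728, 5583945728)
    (edge_strips (symmetric_closure octagon))"
  by code_simp

lemma top_side:
  "addresses top_addresses (7099445248, 7102439424) (5658808320, 5658808320)
    (edge_strips (symmetric_closure octagon))"
  by code_simp

text \<open>The parameter is \<open>(13543/8192, 10725/8192)\<close>; the last two numbers are upper bounds of \<open>1/(b1 - 1)\<close>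
  and \<open>1/(b2 - 1)\<close> in units of \<open>2\<^sup>-\<^sup>3\<^sup>2\<close>.\<close>

lemma hole_dies:
  "dies 28 (7100432384, 7100432384) (5622988800, 5622988800) 6575289122 13890395614 one_box"
  by code_simp

lemma hole_notin_locus: "(13543/8192, 10725/8192) \<notin> connectedness_locus"
proof -
  interpret attractor_pair "13543/8192" "10725/8192" "attractor (13543/8192) (10725/8192)"
    by (rule attractor_pair_attractor) simp_all
  have "(1, 1) \<notin> D"
    by (rule dies_sound[OF hole_dies]) (simp_all add: encloses_def encloses2_def one_box_def)
  then show ?thesis using connected_iff by (simp add: connectedness_locus_def)
qed

theorem corollary7p10:
  shows "connectedness_locus = ({1<..} \<times> {1<..}) - disconnectedness_locus
         \<and> \<not> simply_connected connectedness_locus"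
proof
  show "connectedness_locus = ({1<..} \<times> {1<..}) - disconnectedness_locus"
    by (rule connectedness_locus_eq)
  have in_locus: "(b1, b2) \<in> connectedness_locus"
    if "1733263/1048576 \<le> b1" "b1 \<le> 1733994/1048576" "1363268/1048576 \<le> b2" "b2 \<le> 1381545/1048576"
      and "addresses t C1 C2 (edge_strips (symmetric_closure octagon))" "encloses C1 b1" "encloses C2 b2"
    for b1 b2 t C1 C2
    using that by (intro connectedness_locusI[OF octagon_recurrent _ _ _ that(5-7)])
      (simp_all add: octagon_def encloses_def range1_def range2_def)
  show "\<not> simply_connected connectedness_locus"
  proof (rule not_simply_connected_if_rectangle)
    show "(13543/8192, 10725/8192) \<notin> connectedness_locus" by (rule hole_notin_locus)
    show "(1733263/1048576, y) \<in> connectedness_locus \<and> (1733994/1048576, y) \<in> connectedness_locus"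
      if "1363268/1048576 \<le> y" "y \<le> 1381545/1048576" for y
      using that by (intro conjI in_locus[OF _ _ _ _ left_side] in_locus[OF _ _ _ _ right_side])
        (simp_all add: encloses_def)
    show "(x, 1363268/1048576) \<in> connectedness_locus \<and> (x, 1381545/1048576) \<in> connectedness_locus"
      if "1733263/1048576 \<le> x" "x \<le> 1733994/1048576" for x
      using that by (intro conjI in_locus[OF _ _ _ _ bottom_side] in_locus[OF _ _ _ _ top_side])
        (simp_all add: encloses_def)
  qed simp_all
qed

end
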